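(* If $0<c<1/\mathcal U_1\approx 0.0578391$, then the optimal (infimum) search cost for $\mathcal P\text{-MSP}_2(1,c)$ (searching the plane with two agents of speeds $1$ and $c$) is $\mathcal U_1\approx 17.28935$.
   Context: $\mathcal U_1=\frac{\sqrt{1+\kappa_1^2}}{\kappa_1}e^{2\pi\kappa_1}$, where $\kappa_1$ is the unique positive root of $k^3+k=\frac1{2\pi}$. It is a known theorem (Langetepe, SODA 2010) that $\mathcal U_1$ is the optimal search cost for a single unit-speed agent searching the plane, i.e. for $\mathcal P\text{-MSP}_1(1)$. Polar notation: $\langle \rho,\chi\rangle = \rho(\cos\chi,\sin\chi)$. A point $P=\langle x,\psi\rangle$ exposes $A=\langle y,\psi\rangle$ (with $x,y>0$, same ray from the origin) if $x\ge y$. $[n]=\{0,\dots,n-1\}$. $\mathcal P=\mathbb R^2\setminus\{(0,0)\}$. Problem $\mathcal D\text{-MSP}_n(c)$, for a search domain $\mathcal D\subseteq\mathbb R^2\setminus\{(0,0)\}$ and speeds $c=(c_0,\dots,c_{n-1})$: a feasible solution consists of continuous, piecewise differentiable curves $\tau_i:\mathbb R\to\mathbb R^2$, $i\in[n]$, with $\lim_{t\to-\infty}\tau_i(t)=(0,0)$, such that every $A\in\mathcal D$ is exposed by some point $\tau_i(t)$ of some curve. The parameter $t$ is not physical time: agent $i$ moves along $\tau_i$ at speed $c_i$, so it reaches $\tau_i(t)$ at time $\ell_i(t)/c_i$, where $\ell_i(t)=\int_{-\infty}^t\|\tau_i'(u)\|\,du$. If $t_A^i$ is the earliest parameter at which $\tau_i(t_A^i)$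 exposes $A$ (infinite if none), the search cost of the solution is $\sup_{A\in\mathcal D}\frac1{\|A\|}\min_{i\in[n]}\frac{\ell_i(t_A^i)}{c_i}$. *)

theory Defs
  imports "HOL-Analysis.Analysis"
begin

definition polar :: "real \<Rightarrow> real \<Rightarrow> real^2" where
  "polar \<rho> \<theta> = \<rho> *\<^sub>R vector [cos \<theta>, sin \<theta>]"

definition exposes :: "real^2 \<Rightarrow> real^2 \<Rightarrow> bool" where
  "exposes P A \<longleftrightarrow>
    (\<exists>x y \<psi>. x > 0 \<and> y > 0 \<and> P = polar x \<psi> \<and> A = polar y \<psi> \<and> x \<ge> y)"

(* Breakpoints may be infinite in number but only finitely many lie in any compact
   interval: they can accumulate only at -infinity and +infinity. *)
definition search_curve :: "(real \<Rightarrow> real^2) \<Rightarrow> bool" where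
  "search_curve \<tau> \<longleftrightarrow>
    continuous_on UNIV \<tau> \<and>
    (\<forall>a b. \<tau> piecewise_differentiable_on {a..b}) \<and>
    (\<tau> \<longlongrightarrow> 0) at_bot"

(* Possibly infinite. The breakpoints, where vector_derivative is unspecified, form a null set. *)
definition curve_length :: "(real \<Rightarrow> real^2) \<Rightarrow> real \<Rightarrow> ennreal" where
  "curve_length \<tau> t =
    (\<integral>\<^sup>+ u\<in>{..t}. ennreal (norm (vector_derivative \<tau> (at u))) \<partial>lborel)"

(* For a search curve and A distinct from 0 the exposing parameters form a closed set that is
   bounded below, so the least one exists as soon as there is any. *)
definition exposure_length :: "(real \<Rightarrow> real^2) \<Rightarrow> real^2 \<Rightarrow> ennreal" where
  "exposure_length \<tau> A =
    (if \<exists>t. exposes (\<tau> t) A then curve_length \<tau> (LEAST t. exposes (\<tau> t) A) else \<infinity>)"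

(* The number of agents is the length of the list of speeds; only the first that many
   components of a solution matter. *)
definition msp_feasible :: "(real^2) set \<Rightarrow> real list \<Rightarrow> (nat \<Rightarrow> real \<Rightarrow> real^2) \<Rightarrow> bool" where
  "msp_feasible D cs \<tau> \<longleftrightarrow>
    (\<forall>i<length cs. search_curve (\<tau> i)) \<and>
    (\<forall>A\<in>D. \<exists>i<length cs. \<exists>t. exposes (\<tau> i t) A)"

definition msp_cost :: "(real^2) set \<Rightarrow> real list \<Rightarrow> (nat \<Rightarrow> real \<Rightarrow> real^2) \<Rightarrow> ennreal" where
  "msp_cost D cs \<tau> =
    (SUP A\<in>D. (INF i\<in>{..<length cs}. exposure_length (\<tau> i) A / ennreal (cs ! i))
                / ennreal (norm A))"

definition msp_optimal_cost :: "(real^2) set \<Rightarrow> real list \<Rightarrow> ennreal" where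
  "msp_optimal_cost D cs = (INF \<tau>\<in>{\<tau>. msp_feasible D cs \<tau>}. msp_cost D cs \<tau>)"

definition punctured_plane :: "(real^2) set" where
  "punctured_plane = UNIV - {0}"

definition kappa1 :: real where
  "kappa1 = (THE k. k > 0 \<and> k ^ 3 + k = 1 / (2 * pi))"

definition U1 :: real where
  "U1 = sqrt (1 + kappa1\<^sup>2) / kappa1 * exp (2 * pi * kappa1)"

end

theory Submission
  imports Defs
begin

text \<open>
  An agent of speed \<open>c < 1 / U1\<close> needs time at least \<open>|A| / c > U1 * |A|\<close> to expose \<open>A\<close>, so in a
  solution of cost \<open>C < U1\<close> the agent of speed 1 does everything alone: after length \<open>C * x\<close> it has
  covered the disc of radius \<open>x\<close>, for every \<open>x\<close>. Call a time useful if the current radius is at least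
  the length so far divided by \<open>C\<close>, and let \<open>A \<rho>\<close> be the total angle swept at useful times at
  radius at least \<open>\<rho>\<close>, up to length \<open>C\<close>. By length \<open>C * x\<close> an angle of at least \<open>2 * pi\<close> has been
  swept at radius at least \<open>x\<close>, and all later useful times have radius above \<open>x\<close>; hence at most
  \<open>A x - 2 * pi\<close> of the angle counted by any \<open>A \<rho>\<close> is swept later. With \<open>k = kappa1\<close>, a velocity with
  radial part \<open>u\<close> and tangential part \<open>v\<close> has norm at least \<open>(k * |u| + |v|) / sqrt (1 + k\<^sup>2)\<close>, with
  equality along the logarithmic spiral. Integrating up to length \<open>C * x\<close> gives, for the decreasing
  rearrangement \<open>h\<close> of the radius with respect to the swept angle and for \<open>K = sqrt (1 + k\<^sup>2) * C\<close>, the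
  delay inequality that the integral of \<open>h\<close> over \<open>[\<phi>, \<infinity>)\<close> plus \<open>k * h \<phi>\<close> is at most
  \<open>K * h (\<phi> + 2 * pi)\<close>. Testing it against half a period of \<open>exp (k * x) * sin (b * x)\<close> with small \<open>b\<close>
  yields \<open>K \<ge> sqrt (1 + k\<^sup>2) * U1\<close>. The logarithmic spiral attains \<open>U1\<close>.
\<close>

subsection \<open>Real analysis\<close>

text \<open>One-dimensional area formula as an inequality: measuring the image ignores multiplicity.
  It will convert directions covered into angle swept. The image of \<open>S\<close> is only known
  to be Lebesgue measurable, hence the Borel set \<open>T\<close> inside it.\<close>

lemma emeasure_le_integral_deriv:
  fixes f f' :: "real \<Rightarrow> real"
  assumes S [measurable]: "S \<in> sets borel" and T [measurable]: "T \<in> sets borel"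
    and f'_meas [measurable]: "f' \<in> borel_measurable borel"
    and deriv: "\<And>x. x \<in> S \<Longrightarrow> (f has_real_derivative f' x) (at x)"
    and sub: "T \<subseteq> f ` S"
  shows "emeasure lborel T \<le> (\<integral>\<^sup>+x\<in>S. ennreal \<bar>f' x\<bar> \<partial>lborel)"
proof (cases "(\<integral>\<^sup>+x\<in>S. ennreal \<bar>f' x\<bar> \<partial>lborel) = \<infinity>")
  case False
  \<comment> \<open>\<open>measure_differentiable_image\<close> speaks of maps on
    \<open>real^'n\<close>; on \<open>real^1\<close> the determinant of the derivative is
    \<open>f'\<close> itself.\<close>
  let ?lift = "vec :: real \<Rightarrow> real^1"
  let ?drop = "\<lambda>x::real^1. x $ 1"
  define r where "r = enn2real (\<integral>\<^sup>+x\<in>S. ennreal \<bar>f' x\<bar> \<partial>lborel)"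
  have r: "(\<integral>\<^sup>+x. ennreal (indicator S x * \<bar>f' x\<bar>) \<partial>lborel) = ennreal r" "0 \<le> r"
  proof -
    have "(\<integral>\<^sup>+x. ennreal (indicator S x * \<bar>f' x\<bar>) \<partial>lborel) = (\<integral>\<^sup>+x\<in>S. ennreal \<bar>f' x\<bar> \<partial>lborel)"
      by (intro nn_integral_cong) (auto simp: indicator_def)
    then show "(\<integral>\<^sup>+x. ennreal (indicator S x * \<bar>f' x\<bar>) \<partial>lborel) = ennreal r"
      using False by (simp add: r_def less_top)
  qed (simp add: r_def)
  have "((\<lambda>x. indicator S x * \<bar>f' x\<bar>) has_integral r) UNIV"
    by (rule nn_integral_has_integral [OF _ _ r]) auto
  moreover have "(\<lambda>x. indicator S x * \<bar>f' x\<bar>) = (\<lambda>x. if x \<in> S then \<bar>f' x\<bar> else 0)"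
    by (auto simp: fun_eq_iff indicator_def)
  ultimately have int: "((\<lambda>x. \<bar>f' x\<bar>) has_integral r) S"
    by (simp only: has_integral_restrict_UNIV)
  have S': "?lift ` S \<in> sets lebesgue"
    by (auto intro: differentiable_image_in_sets_lebesgue differentiable_vec)
  let ?F = "?lift \<circ> f \<circ> ?drop"
  have der: "(?F has_derivative (*\<^sub>R) (f' (?drop x))) (at x within ?lift ` S)" if "x \<in> ?lift ` S" for x
  proof -
    from that obtain z where z: "z \<in> S" "x = vec z" by blast
    have "(f has_vector_derivative f' z) (at z within S)"
      using deriv [OF z(1)] by (simp add: has_real_derivative_iff_has_vector_derivative has_vector_derivative_at_within)
    then have "((\<lambda>x. vec (f (x $ 1))) has_derivative (*\<^sub>R) (f' z)) (at (vec z) within ?lift ` S)"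
      by (simp add: has_vector_derivative_def has_derivative_vector_1)
    then show ?thesis by (simp add: z o_def)
  qed
  have det: "\<bar>det (matrix ((*\<^sub>R) (f' (?drop x)) :: real^1 \<Rightarrow> real^1))\<bar> = \<bar>f' (?drop x)\<bar>" for x
    by (simp add: det_1 matrix_def axis_def)
  have int': "((\<lambda>x. \<bar>f' (?drop x)\<bar>) has_integral r) (?lift ` S)"
    by (rule has_integral_vec1_D) (use int in \<open>simp add: o_def image_image\<close>)
  have "?F ` (?lift ` S) \<in> lmeasurable"
    by (rule measurable_differentiable_image [OF S' der]) (use int' in \<open>auto simp: det\<close>)
  then have "((\<lambda>x. 1) has_integral measure lebesgue (?F ` ?lift ` S)) (?F ` ?lift ` S)"
    by (simp add: lmeasure_integral lmeasurable_iff_integrable_on has_integral_iff)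
  from has_integral_vec1_I [OF this]
  have 1: "((\<lambda>x. 1) has_integral measure lebesgue (?F ` ?lift ` S)) (f ` S)"
    by (simp add: o_def image_image)
  have "measure lebesgue (?F ` ?lift ` S) \<le> integral (?lift ` S) (\<lambda>x. \<bar>f' (?drop x)\<bar>)"
    using measure_differentiable_image [OF S' der] int' by (auto simp: det)
  also have "\<dots> = r" using int' by (rule integral_unique)
  finally have "measure lebesgue (f ` S) \<le> r"
    using 1 by (simp add: lmeasure_integral lmeasurable_iff_integrable_on has_integral_iff)
  moreover have fS: "f ` S \<in> lmeasurable"
    using 1 by (auto simp: lmeasurable_iff_integrable_on)
  ultimately have "emeasure lebesgue (f ` S) \<le> ennreal r"
    by (simp add: emeasure_eq_measure2 fmeasurableD ennreal_leI)
  moreover have "emeasure lborel T \<le> emeasure lebesgue (f ` S)"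
  proof -
    have "emeasure lborel T = emeasure lebesgue T" by simp
    also have "\<dots> \<le> emeasure lebesgue (f ` S)"
      using sub fS by (intro emeasure_mono) auto
    finally show ?thesis .
  qed
  ultimately show ?thesis
    using False by (simp add: r_def less_top)
qed simp

subsection \<open>A delay inequality\<close>

text \<open>Integrate \<open>h_ineq\<close> against \<open>w\<close>. Tonelli moves the tail
  integral from \<open>h\<close> to \<open>w\<close>, and a shift by \<open>d\<close> moves the
  delay. With \<open>P\<close> for the integral of the right side, \<open>dual\<close> then gives
  \<open>P + Q \<le> P\<close>, where \<open>Q\<close> is the surplus on the interval from 0 to
  \<open>d\<close>; it is positive because \<open>h\<close> and \<open>V\<close> are.\<close>

lemma no_dual_weight:
  fixes h w :: "real \<Rightarrow> ennreal" and K k B W T d :: real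
  assumes [measurable]: "h \<in> borel_measurable borel" "w \<in> borel_measurable borel"
    and h_le: "\<And>x. h x \<le> ennreal B"
    and h_pos: "\<And>x. 0 < x \<Longrightarrow> x < d \<Longrightarrow> 0 < h x"
    and d: "0 < d"
    and h_ineq: "\<And>x. 0 \<le> x \<Longrightarrow> (\<integral>\<^sup>+y\<in>{x..}. h y \<partial>lborel) + ennreal k * h x \<le> ennreal K * h (x + d)"
    and w_le: "\<And>x. w x \<le> ennreal W"
    and w_supp: "\<And>x. x < 0 \<or> T < x \<Longrightarrow> w x = 0"
    and V_pos: "\<And>y. 0 < y \<Longrightarrow> 0 < (\<integral>\<^sup>+x\<in>{..y}. w x \<partial>lborel)"
    and dual: "\<And>y. d \<le> y \<Longrightarrow> ennreal K * w (y - d) \<le> (\<integral>\<^sup>+x\<in>{..y}. w x \<partial>lborel) + ennreal k * w y"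
  shows False
proof -
  define V where "V = (\<lambda>y. \<integral>\<^sup>+x\<in>{..y}. w x \<partial>lborel)"
  have V_meas [measurable]: "V \<in> borel_measurable borel"
    unfolding V_def atMost_def by measurable
  define P where "P = (\<integral>\<^sup>+y. h y * (ennreal K * w (y - d)) \<partial>lborel)"
  define Q where "Q = (\<integral>\<^sup>+y. h y * (V y * indicator {0<..<d} y) \<partial>lborel)"
  have tonelli: "(\<integral>\<^sup>+x. w x * (\<integral>\<^sup>+y\<in>{x..}. h y \<partial>lborel) \<partial>lborel) = (\<integral>\<^sup>+y. h y * V y \<partial>lborel)"
  proof -
    have "(\<integral>\<^sup>+x. w x * (\<integral>\<^sup>+y\<in>{x..}. h y \<partial>lborel) \<partial>lborel)
        = (\<integral>\<^sup>+x. (\<integral>\<^sup>+y. w x * (h y * indicator {x..} y) \<partial>lborel) \<partial>lborel)"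
      by (intro nn_integral_cong nn_integral_cmult [symmetric]) (auto simp: atLeast_def)
    also have "\<dots> = (\<integral>\<^sup>+y. (\<integral>\<^sup>+x. w x * (h y * indicator {x..} y) \<partial>lborel) \<partial>lborel)"
      by (rule lborel_pair.Fubini') (simp add: atLeast_def)
    also have "\<dots> = (\<integral>\<^sup>+y. (\<integral>\<^sup>+x. h y * (w x * indicator {..y} x) \<partial>lborel) \<partial>lborel)"
      by (intro nn_integral_cong) (auto simp: indicator_def mult_ac)
    also have "\<dots> = (\<integral>\<^sup>+y. h y * V y \<partial>lborel)"
      unfolding V_def by (intro nn_integral_cong nn_integral_cmult) (auto simp: atMost_def)
    finally show ?thesis .
  qed
  have "P + Q = (\<integral>\<^sup>+y. h y * (ennreal K * w (y - d)) + h y * (V y * indicator {0<..<d} y) \<partial>lborel)"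
    unfolding P_def Q_def by (rule nn_integral_add [symmetric]) measurable
  also have "\<dots> \<le> (\<integral>\<^sup>+y. h y * V y + ennreal k * (w y * h y) \<partial>lborel)"
  proof (rule nn_integral_mono)
    fix y :: real
    \<comment> \<open>Below \<open>d\<close> the delayed weight is 0 and \<open>V y\<close> is pure
      gain; from \<open>d\<close> on the indicator is 0 and this is \<open>dual\<close>.\<close>
    have "ennreal K * w (y - d) + V y * indicator {0<..<d} y \<le> V y + ennreal k * w y"
      using dual [of y] w_supp [of "y - d"] by (cases "y < d") (auto simp: V_def indicator_def add_increasing2)
    from mult_left_mono [OF this, of "h y"]
    show "h y * (ennreal K * w (y - d)) + h y * (V y * indicator {0<..<d} y) \<le> h y * V y + ennreal k * (w y * h y)"
      by (simp add: distrib_left mult_ac)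
  qed
  also have "\<dots> = (\<integral>\<^sup>+y. h y * V y \<partial>lborel) + (\<integral>\<^sup>+y. ennreal k * (w y * h y) \<partial>lborel)"
    by (rule nn_integral_add) measurable
  also have "\<dots> = (\<integral>\<^sup>+x. w x * (\<integral>\<^sup>+y\<in>{x..}. h y \<partial>lborel) \<partial>lborel) + (\<integral>\<^sup>+y. ennreal k * (w y * h y) \<partial>lborel)"
    by (simp add: tonelli)
  also have "\<dots> = (\<integral>\<^sup>+x. w x * (\<integral>\<^sup>+y\<in>{x..}. h y \<partial>lborel) + ennreal k * (w x * h x) \<partial>lborel)"
    by (rule nn_integral_add [symmetric]) (auto simp: atLeast_def)
  also have "\<dots> \<le> (\<integral>\<^sup>+x. w x * (ennreal K * h (x + d)) \<partial>lborel)"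
  proof (rule nn_integral_mono)
    fix x :: real
    show "w x * (\<integral>\<^sup>+y\<in>{x..}. h y \<partial>lborel) + ennreal k * (w x * h x) \<le> w x * (ennreal K * h (x + d))"
    proof (cases "x < 0")
      case False
      then show ?thesis
        using mult_left_mono [OF h_ineq [of x], of "w x"] by (simp add: distrib_left mult_ac)
    qed (simp add: w_supp)
  qed
  also have "\<dots> = P"
    unfolding P_def
    by (subst nn_integral_real_affine [where c = 1 and t = d]) (auto simp: mult_ac add.commute)
  finally have "P + Q \<le> P" .
  \<comment> \<open>Only a finite \<open>P\<close> can be cancelled in \<open>ennreal\<close>. The
    bounded support of \<open>w\<close> provides this.\<close>
  moreover have "P < \<infinity>"
  proof -
    have "P \<le> (\<integral>\<^sup>+y. ennreal B * (ennreal K * ennreal W) * indicator {d..T+d} y \<partial>lborel)"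
      unfolding P_def
    proof (rule nn_integral_mono)
      fix y :: real
      show "h y * (ennreal K * w (y - d)) \<le> ennreal B * (ennreal K * ennreal W) * indicator {d..T+d} y"
        using w_supp [of "y - d"] by (auto simp: indicator_def intro!: mult_mono h_le w_le)
    qed
    also have "\<dots> = ennreal B * (ennreal K * ennreal W) * emeasure lborel {d..T+d}"
      by (rule nn_integral_cmult_indicator) simp
    also have "\<dots> < \<infinity>"
      by (simp add: ennreal_mult_less_top emeasure_lborel_Icc_eq)
    finally show ?thesis .
  qed
  ultimately have "Q = 0"
    by (metis add_le_same_cancel1 ennreal_add_left_cancel_le add.right_neutral infinity_ennreal_def le_zero_eq less_irrefl)
  then have "AE y in lborel. h y * (V y * indicator {0<..<d} y) = 0"
    unfolding Q_def by (subst (asm) nn_integral_0_iff_AE) measurable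
  then have "AE y in lborel. y \<notin> {0<..<d}"
    using h_pos V_pos by (auto simp: V_def indicator_def elim!: eventually_mono split: if_splits)
      (metis less_irrefl)+
  then have "emeasure lborel {0<..<d} = 0"
    by (subst (asm) AE_iff_measurable) auto
  with d show False by simp
qed

lemma mult_cos_le_sin:
  fixes x :: real
  assumes "0 \<le> x" "x \<le> pi"
  shows "x * cos x \<le> sin x"
proof -
  have "sin 0 - 0 * cos 0 \<le> sin x - x * cos x"
  proof (rule DERIV_nonneg_imp_nondecreasing [OF assms(1)])
    fix y :: real assume y: "0 \<le> y" "y \<le> x"
    have "((\<lambda>x. sin x - x * cos x) has_real_derivative y * sin y) (at y)"
      by (auto intro!: derivative_eq_intros)
    moreover have "0 \<le> y * sin y" using y assms by (intro mult_nonneg_nonneg sin_ge_zero) auto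
    ultimately show "\<exists>z. ((\<lambda>x. sin x - x * cos x) has_real_derivative z) (at y) \<and> 0 \<le> z" by blast
  qed
  then show ?thesis by simp
qed

text \<open>As \<open>b\<close> tends to 0, \<open>sin (2 * pi * b) / b\<close> tends to
  \<open>2 * pi\<close>, and both inequalities hold strictly in the limit: by
  \<open>2 * pi * k * (1 + k ^ 2) = 1\<close> the first becomes the assumption on \<open>K\<close>
  and the second \<open>2 * pi * k < 1\<close>. The bound 1/4 keeps \<open>2 * pi * b\<close> below
  \<open>pi / 2\<close>.\<close>

lemma exists_frequency:
  fixes k K :: real
  assumes k: "0 < k" "k ^ 3 + k = 1 / (2 * pi)"
    and K: "K < (1 + k\<^sup>2) * exp (2 * pi * k) / k"
  obtains b where "0 < b" "b < 1 / 4" "K * (k\<^sup>2 + b\<^sup>2) * sin (2 * pi * b) \<le> b * exp (2 * pi * k)"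
    "k * sin (2 * pi * b) \<le> b * cos (2 * pi * b)"
proof -
  have 1: "2 * pi * k * (1 + k\<^sup>2) = 1"
    using k by (simp add: field_simps power2_eq_square power3_eq_cube)
  have lim: "((\<lambda>b. sin (2 * pi * b) / b) \<longlongrightarrow> 2 * pi) (at_right 0)"
  proof -
    have "((\<lambda>b. sin (2 * pi * b)) has_real_derivative 2 * pi) (at 0)"
      by (auto intro!: derivative_eq_intros)
    then show ?thesis
      unfolding has_field_derivative_iff by (auto intro: tendsto_within_subset)
  qed
  have "((\<lambda>b. K * (k\<^sup>2 + b\<^sup>2) * (sin (2 * pi * b) / b)) \<longlongrightarrow> K * (k\<^sup>2 + 0\<^sup>2) * (2 * pi)) (at_right 0)"
    by (intro tendsto_intros lim)
  moreover have "K * (k\<^sup>2 + 0\<^sup>2) * (2 * pi) < exp (2 * pi * k)"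
  proof -
    have "K * k < (1 + k\<^sup>2) * exp (2 * pi * k)" using K k(1) by (simp add: field_simps)
    then have "K * k * (2 * pi * k) < (1 + k\<^sup>2) * exp (2 * pi * k) * (2 * pi * k)" using k(1) by simp
    also have "\<dots> = (2 * pi * k * (1 + k\<^sup>2)) * exp (2 * pi * k)" by (simp only: mult_ac)
    also have "\<dots> = exp (2 * pi * k)" by (simp only: 1 mult_1)
    finally show ?thesis by (simp add: power2_eq_square mult_ac)
  qed
  ultimately have e1: "\<forall>\<^sub>F b in at_right 0. K * (k\<^sup>2 + b\<^sup>2) * (sin (2 * pi * b) / b) < exp (2 * pi * k)"
    by (rule order_tendstoD)
  have "((\<lambda>b. cos (2 * pi * b) - k * (sin (2 * pi * b) / b)) \<longlongrightarrow> cos (2 * pi * 0) - k * (2 * pi)) (at_right 0)"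
    by (intro tendsto_intros lim)
  moreover have "0 < cos (2 * pi * 0) - k * (2 * pi)"
  proof -
    have "2 * pi * k * 1 < 2 * pi * k * (1 + k\<^sup>2)" using k(1) by (intro mult_strict_left_mono) auto
    with 1 show ?thesis by (simp add: mult_ac)
  qed
  ultimately have e2: "\<forall>\<^sub>F b in at_right 0. 0 < cos (2 * pi * b) - k * (sin (2 * pi * b) / b)"
    by (rule order_tendstoD)
  have e3: "\<forall>\<^sub>F b in at_right (0::real). b \<in> {0<..<1/4}"
    by (rule eventually_at_right_real) simp
  have "\<exists>b. 0 < b \<and> b < 1 / 4 \<and> K * (k\<^sup>2 + b\<^sup>2) * (sin (2 * pi * b) / b) < exp (2 * pi * k)
      \<and> 0 < cos (2 * pi * b) - k * (sin (2 * pi * b) / b)"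
    using eventually_happens [OF eventually_conj [OF e1 eventually_conj [OF e2 e3]]] by auto
  then obtain b where b: "0 < b" "b < 1 / 4" "K * (k\<^sup>2 + b\<^sup>2) * (sin (2 * pi * b) / b) < exp (2 * pi * k)"
      "0 < cos (2 * pi * b) - k * (sin (2 * pi * b) / b)" by blast
  from b show thesis
    by (intro that [of b]) (simp_all add: field_simps)
qed

text \<open>For \<open>h y = exp (- l * y)\<close> with \<open>l > 0\<close> the inequality reads
  \<open>(1 / l + k) * exp (2 * pi * l) \<le> K\<close>. By the equation for \<open>k\<close> the
  left side is least at \<open>l = k\<close>, and its value there is the bound.\<close>

lemma delay_inequality_bound:
  fixes h :: "real \<Rightarrow> ennreal" and K k B :: real
  assumes k: "0 < k" "k ^ 3 + k = 1 / (2 * pi)"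
    and h_meas: "h \<in> borel_measurable borel"
    and h_le: "\<And>x. h x \<le> ennreal B"
    and h_pos: "\<And>x. 0 < x \<Longrightarrow> x < 2 * pi \<Longrightarrow> 0 < h x"
    and h_ineq: "\<And>x. 0 \<le> x \<Longrightarrow>
      (\<integral>\<^sup>+y\<in>{x..}. h y \<partial>lborel) + ennreal k * h x \<le> ennreal K * h (x + 2 * pi)"
  shows "(1 + k\<^sup>2) * exp (2 * pi * k) / k \<le> K"
proof (rule ccontr)
  assume "\<not> ?thesis"
  then have "K < (1 + k\<^sup>2) * exp (2 * pi * k) / k" by simp
  then obtain b where b: "0 < b" "b < 1 / 4" and Kb: "K * (k\<^sup>2 + b\<^sup>2) * sin (2 * pi * b) \<le> b * exp (2 * pi * k)"
    and kb: "k * sin (2 * pi * b) \<le> b * cos (2 * pi * b)"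
    by (rule exists_frequency [OF k])
  define T where "T = pi / b"
  have T: "0 < T" "b * T = pi" "2 * pi < T" using b by (auto simp: T_def field_simps)
  define q where "q = k\<^sup>2 + b\<^sup>2"
  have q: "0 < q" using k b by (auto simp: q_def intro: add_pos_pos)
  define f where "f = (\<lambda>x. exp (k * x) * sin (b * x))"
  define F where "F = (\<lambda>x. exp (k * x) * (k * sin (b * x) - b * cos (b * x)) / q)"
  \<comment> \<open>\<open>exp (k * x)\<close> is the weight dual to the critical solution \<open>exp (- k * x)\<close>. Below the critical
    \<open>K\<close> the characteristic equation has complex roots, which turn it into a half-wave.\<close>
  define w where "w = (\<lambda>x. ennreal (f x) * indicator {0..T} x)"
  have f_nonneg: "0 \<le> f x" if "0 \<le> x" "x \<le> T" for x
  proof -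
    have "b * x \<le> b * T" using that b by simp
    then show ?thesis using that b T unfolding f_def by (intro mult_nonneg_nonneg sin_ge_zero) auto
  qed
  have F_deriv: "(F has_real_derivative f x) (at x)" for x
  proof -
    have "((\<lambda>x. exp (k * x) * (k * sin (b * x) - b * cos (b * x))) has_real_derivative f x * q) (at x)"
      by (auto intro!: derivative_eq_intros simp: f_def q_def algebra_simps power2_eq_square)
    from DERIV_cdivide [OF this, of q] show ?thesis
      using q by (simp add: F_def)
  qed
  have f_meas [measurable]: "f \<in> borel_measurable borel" unfolding f_def by measurable
  have V: "(\<integral>\<^sup>+x\<in>{..y}. w x \<partial>lborel) = ennreal (F (min y T) - F 0)" if "0 \<le> y" for y
  proof -
    have "(\<integral>\<^sup>+x\<in>{..y}. w x \<partial>lborel) = (\<integral>\<^sup>+x. ennreal (f x) * indicator {0..min y T} x \<partial>lborel)"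
      by (intro nn_integral_cong) (auto simp: w_def indicator_def)
    also have "\<dots> = ennreal (F (min y T) - F 0)"
      using that T by (intro nn_integral_FTC_Icc F_deriv [THEN DERIV_subset] f_nonneg) auto
    finally show ?thesis .
  qed
  have F0: "F 0 = - b / q" by (simp add: F_def)
  have FT: "F T = exp (k * T) * b / q" by (simp add: F_def T)
  have sinpos: "0 < sin (2 * pi * b)" using b by (intro sin_gt_zero) auto
  have cosb: "2 * pi * b * cos (2 * pi * b) \<le> sin (2 * pi * b)"
    using b by (intro mult_cos_le_sin) auto
  have Kb': "K * q * sin (2 * pi * b) \<le> b * exp (2 * pi * k)" using Kb by (simp add: q_def)
  show False
  proof (rule no_dual_weight [of h w B "2 * pi" k K "exp (k * T)" T])
    show "h \<in> borel_measurable borel" by fact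
    show "w \<in> borel_measurable borel" unfolding w_def by measurable
    show "w x \<le> ennreal (exp (k * T))" for x
    proof -
      have "exp (k * x) * sin (b * x) \<le> exp (k * T) * 1" if "x \<le> T" "0 \<le> x"
        using that k f_nonneg [of x] by (intro mult_mono) (auto simp: f_def zero_le_mult_iff)
      then show ?thesis by (auto simp: w_def f_def indicator_def intro!: ennreal_leI)
    qed
    show "w x = 0" if "x < 0 \<or> T < x" for x using that by (auto simp: w_def)
    show "0 < (\<integral>\<^sup>+x\<in>{..y}. w x \<partial>lborel)" if "0 < y" for y
    proof -
      have "F 0 < F (min y T)"
      proof (rule DERIV_pos_imp_increasing_open [of 0 "min y T" F])
        show "\<exists>z. DERIV F x :> z \<and> 0 < z" if "0 < x" "x < min y T" for x
        proof -
          have "b * x < b * T" using that b by simp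
          then have "0 < f x" using that b T unfolding f_def by (intro mult_pos_pos sin_gt_zero) auto
          with F_deriv show ?thesis by blast
        qed
        show "continuous_on {0..min y T} F"
          by (rule DERIV_continuous_on [OF DERIV_subset [OF F_deriv subset_UNIV]])
      qed (use that T in auto)
      then show ?thesis using V [of y] that by (simp add: ennreal_less_zero_iff)
    qed
    show "ennreal K * w (y - 2 * pi) \<le> (\<integral>\<^sup>+x\<in>{..y}. w x \<partial>lborel) + ennreal k * w y"
      if y: "2 * pi \<le> y" for y
    proof -
      have y0: "0 \<le> y" using y pi_gt_zero by linarith
      \<comment> \<open>For positive \<open>K\<close>: the half-wave lives on \<open>{0..T}\<close>
        and its delayed copy on \<open>{2 * pi..T + 2 * pi}\<close>, so from \<open>2 * pi\<close>
        on there is first an overlap, then the copy alone, then neither.\<close>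
      consider "K \<le> 0" | "0 < K" "y \<le> T" | "0 < K" "T < y" "y \<le> T + 2 * pi" | "T + 2 * pi < y" by linarith
      then show ?thesis
      proof cases
        case 1 then show ?thesis by (simp add: ennreal_neg)
      next
        case 4 then show ?thesis by (simp add: w_def)
      next
        case 2
        define s c where "s = sin (b * y)" and "c = cos (b * y)"
        define S C where "S = sin (2 * pi * b)" and "C = cos (2 * pi * b)"
        have S0: "0 < S" using sinpos by (simp add: S_def)
        have s: "0 \<le> s" using f_nonneg [of y] y0 2 by (simp add: f_def s_def zero_le_mult_iff)
        have shift: "f (y - 2 * pi) = exp (k * y) / exp (2 * pi * k) * (s * C - c * S)"
        proof -
          have "b * (y - 2 * pi) = b * y - 2 * pi * b" "k * (y - 2 * pi) = k * y - 2 * pi * k"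
            by (simp_all add: algebra_simps)
          then show ?thesis by (simp add: f_def s_def c_def S_def C_def sin_diff exp_diff)
        qed
        have nn: "0 \<le> s * C - c * S"
          using f_nonneg [of "y - 2 * pi"] y 2 T pi_gt_zero unfolding shift by (simp add: zero_le_mult_iff zero_le_divide_iff)
        \<comment> \<open>Replacing \<open>K\<close> by this bound gives \<open>c\<close> exactly
          its coefficient in \<open>F y + k * f y\<close>. The coefficient of \<open>s\<close> is
          compared in \<open>cot\<close>, where \<open>x * cot x \<le> 1\<close> and the equation
          for \<open>k\<close> enter.\<close>
        have KS: "K / exp (2 * pi * k) \<le> b / (q * S)"
          using Kb' q sinpos by (simp add: S_def field_simps)
        have cot: "b * C / S \<le> k + k * q"
        proof -
          have "b * C / S \<le> 1 / (2 * pi)" using cosb sinpos by (simp add: S_def C_def field_simps)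
          also have "\<dots> = k + k * k\<^sup>2" using k(2) by (simp add: power2_eq_square power3_eq_cube)
          also have "\<dots> \<le> k + k * q" using k(1) by (simp add: q_def)
          finally show ?thesis .
        qed
        have "K * f (y - 2 * pi) = exp (k * y) * (K / exp (2 * pi * k) * (s * C - c * S))"
          by (simp add: shift)
        also have "\<dots> \<le> exp (k * y) * (b / (q * S) * (s * C - c * S))"
          by (intro mult_left_mono mult_right_mono KS nn) simp
        also have "b / (q * S) * (s * C - c * S) = (s * (b * C / S) - b * c) / q"
          using q S0 by (simp add: field_simps)
        also have "exp (k * y) * ((s * (b * C / S) - b * c) / q) \<le> exp (k * y) * ((s * (k + k * q) - b * c) / q)"
          by (intro mult_left_mono divide_right_mono diff_mono cot s) (use q b in auto)
        also have "\<dots> = F y + k * f y"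
          using q by (simp add: F_def f_def s_def c_def field_simps)
        finally have "K * f (y - 2 * pi) \<le> (F y - F 0) + k * f y"
          using b q F0 by (smt (verit) divide_nonneg_pos minus_divide_left)
        moreover have "0 \<le> F y - F 0"
          using DERIV_nonneg_imp_nondecreasing [OF y0, of F] F_deriv f_nonneg 2 by (meson diff_ge_0_iff_ge order_trans)
        moreover have "y - 2 * pi \<le> T" using 2 pi_gt_zero by linarith
        then have "w y = ennreal (f y)" "w (y - 2 * pi) = ennreal (f (y - 2 * pi))"
          using 2 y y0 by (simp_all add: w_def indicator_def)
        ultimately show ?thesis
          using 2 k f_nonneg [of y] V [OF y0] y0
          by (simp add: ennreal_mult' [symmetric] ennreal_plus [symmetric] ennreal_leI del: ennreal_plus)
      next
        case 3
        \<comment> \<open>The distance from \<open>y\<close> to the end of the delayed half-wave.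
          Reflecting the sine at \<open>pi\<close> makes \<open>f (y - 2 * pi)\<close> a constant
          multiple of \<open>exp (- k * v) * sin (b * v)\<close>.\<close>
        define v where "v = T + 2 * pi - y"
        have v: "0 \<le> v" "v \<le> 2 * pi" using 3 by (auto simp: v_def)
        have le_half: "b * u \<le> pi / 2" if "u \<le> 2 * pi" for u
        proof -
          have "b * u \<le> b * (2 * pi)" using that b by simp
          also have "\<dots> \<le> 1/4 * (2 * pi)" using b by (intro mult_right_mono) auto
          finally show ?thesis by simp
        qed
        \<comment> \<open>By \<open>kb\<close> the function increases up to \<open>2 * pi\<close>,
          so the worst case is \<open>y = T\<close>, which \<open>Kb'\<close> settles.\<close>
        have "exp (- k * v) * sin (b * v) \<le> exp (- k * (2 * pi)) * sin (b * (2 * pi))"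
        proof (rule DERIV_nonneg_imp_nondecreasing [OF v(2), of "\<lambda>u. exp (- k * u) * sin (b * u)"])
          fix u assume u: "v \<le> u" "u \<le> 2 * pi"
          have bu: "0 \<le> b * u" "b * u \<le> b * (2 * pi)" using u v b by auto
          have "- (pi / 2) \<le> b * u" using bu(1) pi_gt_zero by linarith
          then have "k * sin (b * u) \<le> k * sin (2 * pi * b)"
            using bu le_half [of "2 * pi"] k by (intro mult_left_mono sin_monotone_2pi_le) (auto simp: mult_ac)
          also note kb
          also have "b * cos (2 * pi * b) \<le> b * cos (b * u)"
            using bu le_half [of "2 * pi"] b by (intro mult_left_mono cos_monotone_0_pi_le) (auto simp: mult_ac)
          finally have "0 \<le> exp (- k * u) * (b * cos (b * u) - k * sin (b * u))" by simp
          moreover have "((\<lambda>u. exp (- k * u) * sin (b * u)) has_real_derivative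
              exp (- k * u) * (b * cos (b * u) - k * sin (b * u))) (at u)"
            by (auto intro!: derivative_eq_intros simp: algebra_simps)
          ultimately show "\<exists>z. ((\<lambda>u. exp (- k * u) * sin (b * u)) has_real_derivative z) (at u) \<and> 0 \<le> z"
            by blast
        qed
        moreover have "f (y - 2 * pi) = exp (k * T) * (exp (- k * v) * sin (b * v))"
        proof -
          have "k * (y - 2 * pi) = k * T + - k * v" "b * (y - 2 * pi) = pi - b * v"
            using T(2) by (simp_all add: v_def algebra_simps)
          then show ?thesis unfolding f_def by (simp only: exp_add sin_pi_minus mult.assoc)
        qed
        ultimately have "K * f (y - 2 * pi) \<le> K * (exp (k * T) * (exp (- k * (2 * pi)) * sin (b * (2 * pi))))"
          using 3 by simp
        also have "\<dots> = exp (k * T) * (K * sin (2 * pi * b) / exp (2 * pi * k))"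
          by (simp add: exp_minus field_simps)
        also have "\<dots> \<le> exp (k * T) * (b / q)"
          using Kb' q by (intro mult_left_mono) (simp_all add: field_simps)
        also have "\<dots> \<le> F T - F 0" using b q by (simp add: FT F0)
        finally have "K * f (y - 2 * pi) \<le> F T - F 0" .
        moreover have "w (y - 2 * pi) = ennreal (f (y - 2 * pi))" "w y = 0"
          using 3 y by (simp_all add: w_def indicator_def)
        ultimately show ?thesis
          using 3 V [OF y0] by (simp add: ennreal_mult' [symmetric] ennreal_leI)
      qed
    qed
  qed (use h_le h_pos h_ineq in auto)
qed

subsection \<open>Curves in the complex plane\<close>

text \<open>Off \<open>N\<close> the derivative is a pointwise limit of measurable difference
  quotients, and values on a countable set do not affect Borel measurability.\<close>

lemma has_vector_derivative_borel_measurable: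
  fixes f f' :: "real \<Rightarrow> 'a::{real_normed_vector, second_countable_topology}"
  assumes cont: "continuous_on UNIV f" and N: "countable N"
    and deriv: "\<And>t. t \<notin> N \<Longrightarrow> (f has_vector_derivative f' t) (at t)"
  shows "f' \<in> borel_measurable borel"
proof (rule measurable_discrete_difference [OF _ N])
  show "(\<lambda>t. if t \<in> N then 0 else f' t) \<in> borel_measurable borel"
  proof (rule borel_measurable_LIMSEQ_metric)
    have [measurable]: "f \<in> borel_measurable borel"
      using cont by (rule borel_measurable_continuous_onI)
    have [measurable]: "N \<in> sets borel"
      using N by (rule sets.countable [rotated]) simp
    fix n :: nat
    show "(\<lambda>t. if t \<in> N then 0 else (f (t + 1 / real (Suc n)) - f t) /\<^sub>R (1 / real (Suc n)))
        \<in> borel_measurable borel"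
      by measurable
  next
    fix t :: real
    show "(\<lambda>n. if t \<in> N then 0 else (f (t + 1 / real (Suc n)) - f t) /\<^sub>R (1 / real (Suc n)))
        \<longlonglongrightarrow> (if t \<in> N then 0 else f' t)"
    proof (cases "t \<in> N")
      case False
      have "((\<lambda>h. norm (f (t + h) - f t - h *\<^sub>R f' t) / norm h) \<longlongrightarrow> 0) (at 0)"
        using deriv [OF False] by (simp add: has_vector_derivative_def has_derivative_at)
      moreover have "\<forall>\<^sub>F h in at 0. norm (f (t + h) - f t - h *\<^sub>R f' t) / norm h
          = norm ((f (t + h) - f t) /\<^sub>R h - f' t)"
      proof (rule eventually_at_filter [THEN iffD2, OF always_eventually], intro allI impI)
        fix h :: real assume "h \<noteq> 0"
        then have "(f (t + h) - f t) /\<^sub>R h - f' t = (f (t + h) - f t - h *\<^sub>R f' t) /\<^sub>R h"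
          by (simp add: scaleR_diff_right)
        then show "norm (f (t + h) - f t - h *\<^sub>R f' t) / norm h = norm ((f (t + h) - f t) /\<^sub>R h - f' t)"
          by (simp add: divide_inverse mult.commute)
      qed
      ultimately have "((\<lambda>h. norm ((f (t + h) - f t) /\<^sub>R h - f' t)) \<longlongrightarrow> 0) (at 0)"
        by (rule Lim_transform_eventually)
      then have "((\<lambda>h. (f (t + h) - f t) /\<^sub>R h) \<longlongrightarrow> f' t) (at 0)"
        by (simp add: tendsto_norm_zero_iff flip: Lim_null)
      moreover have "filterlim (\<lambda>n. 1 / real (Suc n)) (at 0) sequentially"
        by (intro filterlim_atI LIMSEQ_Suc [OF lim_1_over_n]) auto
      ultimately show ?thesis
        using False by (auto dest: filterlim_compose)
    qed simp
  qed
qed auto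

text \<open>The fundamental theorem holds for the gauge integral without absolute integrability of
  \<open>F'\<close>. If the right side is finite, \<open>\<bar>F'\<bar>\<close> is integrable and
  dominates \<open>F'\<close>; if it is infinite, nothing is to be shown.\<close>

lemma diff_le_integral_abs_deriv:
  fixes F F' :: "real \<Rightarrow> real"
  assumes "finite N" "a \<le> b" "continuous_on {a..b} F"
    and deriv: "\<And>t. t \<in> {a<..<b} - N \<Longrightarrow> (F has_real_derivative F' t) (at t)"
    and [measurable]: "F' \<in> borel_measurable borel"
  shows "ennreal (F b - F a) \<le> (\<integral>\<^sup>+t\<in>{a..b}. ennreal \<bar>F' t\<bar> \<partial>lborel)"
proof (cases "(\<integral>\<^sup>+t\<in>{a..b}. ennreal \<bar>F' t\<bar> \<partial>lborel) = \<infinity>")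
  case False
  define r where "r = enn2real (\<integral>\<^sup>+t\<in>{a..b}. ennreal \<bar>F' t\<bar> \<partial>lborel)"
  have r: "(\<integral>\<^sup>+t\<in>{a..b}. ennreal \<bar>F' t\<bar> \<partial>lborel) = ennreal r" "0 \<le> r"
    using False by (simp_all add: r_def less_top)
  have "(\<integral>\<^sup>+t. ennreal (if t \<in> {a..b} then \<bar>F' t\<bar> else 0) \<partial>lborel) = ennreal r"
    unfolding r(1) [symmetric] by (intro nn_integral_cong) (auto simp: indicator_def)
  then have "((\<lambda>t. if t \<in> {a..b} then \<bar>F' t\<bar> else 0) has_integral r) UNIV"
    by (intro nn_integral_has_integral r(2)) auto
  then have abs: "((\<lambda>t. \<bar>F' t\<bar>) has_integral r) {a..b}"
    by (simp only: has_integral_restrict_UNIV)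
  have "(F' has_integral (F b - F a)) {a..b}"
    using assms by (intro fundamental_theorem_of_calculus_interior_strong [of N])
      (auto simp: has_real_derivative_iff_has_vector_derivative)
  then have "F b - F a \<le> r"
    using abs by (rule has_integral_le) simp
  with r show ?thesis by (simp add: ennreal_leI)
qed simp

text \<open>For a point \<open>z\<close> moving with velocity \<open>w\<close>, the left side is the
  rate of change of its modulus; the right side expresses it by the logarithmic derivative. Both are
  0 at \<open>z = 0\<close>.\<close>

lemma inner_sgn_complex: "w \<bullet> sgn z = cmod z * Re (w / z)"
proof (cases "z = 0")
  case False
  then have "cmod z * Re (w / z) = (Re w * Re z + Im w * Im z) / cmod z"
    by (simp add: Re_divide flip: cmod_power2) (simp add: power2_eq_square)
  then show ?thesis
    by (simp add: inner_complex_def sgn_eq add_divide_distrib)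
qed simp

text \<open>A nonempty down-closed set, whether a half-line with or without its end or the whole
  line, is an increasing union of sets \<open>{..t}\<close> with \<open>t\<close> in it, and the
  density measure is continuous from below.\<close>

lemma nn_integral_down_closed_le:
  fixes f :: "real \<Rightarrow> ennreal" and S :: "real set"
  assumes [measurable]: "f \<in> borel_measurable borel"
    and down: "\<And>s t. t \<in> S \<Longrightarrow> s \<le> t \<Longrightarrow> s \<in> S"
    and bound: "\<And>t. t \<in> S \<Longrightarrow> (\<integral>\<^sup>+u\<in>{..t}. f u \<partial>lborel) \<le> B"
  shows "(\<integral>\<^sup>+u\<in>S. f u \<partial>lborel) \<le> B"
proof (cases "S = {}")
  case False
  have "\<exists>A :: nat \<Rightarrow> real set. range A \<subseteq> atMost ` S \<and> incseq A \<and> (\<Union>n. A n) = S"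
  proof (cases "bdd_above S")
    case True
    define b where "b = Sup S"
    have ub: "t \<le> b" if "t \<in> S" for t using that True by (simp add: b_def cSup_upper)
    have lt: "s \<in> S" if "s < b" for s
      using that False down unfolding b_def by (meson less_cSupE less_imp_le)
    show ?thesis
    proof (cases "b \<in> S")
      case True
      then have "S = {..b}" using ub down by auto
      with True show ?thesis by (intro exI [of _ "\<lambda>_. {..b}"]) auto
    next
      case False
      let ?A = "\<lambda>n. {..b - 1 / real (Suc n)}"
      have "range ?A \<subseteq> atMost ` S" using lt by auto
      moreover have "incseq ?A"
        by (auto simp: incseq_def intro!: divide_left_mono diff_left_mono elim!: order_trans)
      moreover have "(\<Union>n. ?A n) = S"
      proof safe
        fix t assume t: "t \<in> S"
        then have "t < b" using ub [OF t] False by (metis less_eq_real_def)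
        then obtain n where "1 / real (Suc n) < b - t"
          using nat_approx_posE [of "b - t"] by auto
        then show "t \<in> (\<Union>n. ?A n)" by (auto intro!: exI [of _ n])
      next
        fix t n assume "t \<le> b - 1 / real (Suc n)"
        also have "\<dots> < b" by simp
        finally show "t \<in> S" by (rule lt)
      qed
      ultimately show ?thesis by blast
    qed
  next
    case False
    have "t \<in> S" for t
    proof -
      from False obtain s where "s \<in> S" "t < s" unfolding bdd_above_def by (meson not_le)
      then show ?thesis using down by (simp add: less_imp_le)
    qed
    then have "S = UNIV" by blast
    then show ?thesis
      by (intro exI [of _ "\<lambda>n. {..real n}"]) (auto simp: incseq_def intro: real_arch_simple)
  qed
  then obtain A :: "nat \<Rightarrow> real set" where A: "range A \<subseteq> atMost ` S" "incseq A" "(\<Union>n. A n) = S" by blast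
  have meas: "A n \<in> sets borel" for n using subsetD [OF A(1), of "A n"] by auto
  have [measurable]: "S \<in> sets borel" unfolding A(3) [symmetric] using meas by auto
  have "(\<integral>\<^sup>+u\<in>S. f u \<partial>lborel) = emeasure (density lborel f) S"
    by (simp add: emeasure_density)
  also have "\<dots> = (SUP n. emeasure (density lborel f) (A n))"
    using SUP_emeasure_incseq [OF _ A(2), of "density lborel f"] meas by (simp add: A(3) image_subset_iff)
  also have "\<dots> \<le> B"
  proof (rule SUP_least)
    fix n
    obtain t where "t \<in> S" "A n = {..t}" using A(1) by auto
    then show "emeasure (density lborel f) (A n) \<le> B"
      using bound [of t] by (simp add: emeasure_density)
  qed
  finally show ?thesis .
qed simp

text \<open>Cauchy-Schwarz for the vectors with entries \<open>k\<close>, 1 and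
  \<open>\<bar>Re z\<bar>\<close>, \<open>\<bar>Im z\<bar>\<close>; the square in the proof is the
  defect.\<close>

lemma weighted_abs_Im_Re_le:
  fixes z :: complex and k :: real
  assumes "0 \<le> k"
  shows "k * \<bar>Re z\<bar> + \<bar>Im z\<bar> \<le> sqrt (1 + k\<^sup>2) * cmod z"
proof -
  have "(k * \<bar>Re z\<bar> + \<bar>Im z\<bar>)\<^sup>2 \<le> (1 + k\<^sup>2) * ((Re z)\<^sup>2 + (Im z)\<^sup>2)"
    using zero_le_power2 [of "\<bar>Re z\<bar> - k * \<bar>Im z\<bar>"]
    by (simp add: power2_eq_square algebra_simps)
  then show ?thesis
    using assms by (simp add: cmod_def real_le_rsqrt flip: real_sqrt_mult)
qed

text \<open>In \<open>complex\<close> the quotient \<open>g' / g\<close> splits the velocity: its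
  real part is the relative radial rate, its imaginary part the angular rate. The values of
  \<open>g'\<close> at exceptional times are arbitrary.\<close>

locale planar_curve =
  fixes g g' :: "real \<Rightarrow> complex"
  assumes cont: "continuous_on UNIV g"
    and lim: "(g \<longlongrightarrow> 0) at_bot"
    and finite_exceptions:
      "\<exists>N. finite N \<and> (\<forall>t\<in>{a..b} - N. (g has_vector_derivative g' t) (at t))"
begin

lemma countable_exceptions:
  obtains N where "countable N" "\<And>t. t \<notin> N \<Longrightarrow> (g has_vector_derivative g' t) (at t)"
proof -
  have "\<forall>n::nat. \<exists>N. finite N \<and> (\<forall>t\<in>{-real n..real n} - N. (g has_vector_derivative g' t) (at t))"
    using finite_exceptions by blast
  then obtain N where N: "\<And>n::nat. finite (N n)"
    "\<And>n t. t \<in> {-real n..real n} - N n \<Longrightarrow> (g has_vector_derivative g' t) (at t)" by metis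
  show thesis
  proof (rule that)
    show "countable (\<Union>n. N n)" using N(1) by (simp add: countable_finite)
    show "(g has_vector_derivative g' t) (at t)" if t: "t \<notin> (\<Union>n. N n)" for t
    proof -
      obtain n :: nat where "\<bar>t\<bar> \<le> real n" using real_arch_simple by blast
      then show ?thesis using t by (intro N(2) [of _ n]) auto
    qed
  qed
qed

lemma g_measurable [measurable]: "g \<in> borel_measurable borel"
  using cont by (rule borel_measurable_continuous_onI)

lemma g'_measurable [measurable]: "g' \<in> borel_measurable borel"
  by (rule countable_exceptions, rule has_vector_derivative_borel_measurable [OF cont])

section \<open>Length and the polar components of the velocity\<close>

definition len :: "real \<Rightarrow> ennreal" where
  "len t = (\<integral>\<^sup>+u\<in>{..t}. ennreal (cmod (g' u)) \<partial>lborel)"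

lemma len_mono: "s \<le> t \<Longrightarrow> len s \<le> len t"
  unfolding len_def by (intro nn_integral_mono) (auto simp: indicator_def)

lemma len_measurable [measurable]: "len \<in> borel_measurable borel"
  unfolding len_def atMost_def by measurable

text \<open>Both are 0 where \<open>g t = 0\<close>, since division by 0 gives 0.\<close>

definition radial :: "real \<Rightarrow> real" where
  "radial t = cmod (g t) * \<bar>Re (g' t / g t)\<bar>"

definition angular :: "real \<Rightarrow> real" where
  "angular t = \<bar>Im (g' t / g t)\<bar>"

lemma radial_measurable [measurable]: "radial \<in> borel_measurable borel"
  and angular_measurable [measurable]: "angular \<in> borel_measurable borel"
  unfolding radial_def angular_def by measurable

lemma angular_nonneg: "0 \<le> angular t" and radial_nonneg: "0 \<le> radial t"
  by (simp_all add: angular_def radial_def)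

lemma speed_decomp_le:
  assumes "0 \<le> k"
  shows "k * radial t + cmod (g t) * angular t \<le> sqrt (1 + k\<^sup>2) * cmod (g' t)"
proof (cases "g t = 0")
  case False
  have "cmod (g t) * (k * \<bar>Re (g' t / g t)\<bar> + \<bar>Im (g' t / g t)\<bar>)
      \<le> cmod (g t) * (sqrt (1 + k\<^sup>2) * cmod (g' t / g t))"
    by (intro mult_left_mono weighted_abs_Im_Re_le assms) simp
  then show ?thesis
    using False by (simp add: radial_def angular_def norm_divide algebra_simps)
qed (simp add: radial_def)

lemma radial_le_speed: "radial t \<le> cmod (g' t)"
proof (cases "g t = 0")
  case False
  have "cmod (g t) * \<bar>Re (g' t / g t)\<bar> \<le> cmod (g t) * cmod (g' t / g t)"
    by (intro mult_left_mono abs_Re_le_cmod) simp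
  then show ?thesis using False by (simp add: radial_def norm_divide)
qed (simp add: radial_def)

lemma norm_le_integral_radial: "ennreal (cmod (g t)) \<le> (\<integral>\<^sup>+u\<in>{..t}. ennreal (radial u) \<partial>lborel)"
proof -
  \<comment> \<open>\<open>cmod \<circ> g\<close> may fail to be differentiable at the zeros of \<open>g\<close>, so integrate only from the last
    time at distance \<open>e\<close>.\<close>
  have main: "ennreal (cmod (g t) - e) \<le> (\<integral>\<^sup>+u\<in>{..t}. ennreal (radial u) \<partial>lborel)" if e: "0 < e" for e
  proof (cases "cmod (g t) \<le> e")
    case False
    define X where "X = {s. s \<le> t \<and> cmod (g s) \<le> e}"
    have "\<forall>\<^sub>F s in at_bot. cmod (g s) < e"
      using lim e by (auto simp: tendsto_iff)
    then have "\<exists>s \<le> t. cmod (g s) < e"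
      by (metis eventually_at_bot_linorder linear)
    then have X_ne: "X \<noteq> {}" by (auto simp: X_def intro: less_imp_le)
    have X_bdd: "bdd_above X" by (auto simp: X_def bdd_above_def)
    have "closed X"
      unfolding X_def by (intro closed_Collect_conj closed_Collect_le continuous_intros cont)
    then have s: "Sup X \<in> X" using X_ne X_bdd by (intro closed_contains_Sup)
    define s where "s = Sup X"
    have s_le: "s \<le> t" "cmod (g s) \<le> e" using s by (auto simp: s_def X_def)
    have gt: "e < cmod (g u)" if "s < u" "u \<le> t" for u
      using that cSup_upper [OF _ X_bdd, of u] by (fastforce simp: s_def X_def)
    obtain N where N: "finite N" "\<And>u. u \<in> {s..t} - N \<Longrightarrow> (g has_vector_derivative g' u) (at u)"
      using finite_exceptions [of s t] by blast
    have "ennreal (cmod (g t) - e) \<le> ennreal (cmod (g t) - cmod (g s))"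
      using s_le by (intro ennreal_leI) simp
    also have "\<dots> \<le> (\<integral>\<^sup>+u\<in>{s..t}. ennreal \<bar>cmod (g u) * Re (g' u / g u)\<bar> \<partial>lborel)"
    proof (rule diff_le_integral_abs_deriv [OF N(1) s_le(1)])
      show "continuous_on {s..t} (\<lambda>u. cmod (g u))"
        by (intro continuous_intros continuous_on_subset [OF cont]) auto
      fix u assume u: "u \<in> {s<..<t} - N"
      then have "g u \<noteq> 0" using gt [of u] e by auto
      moreover have "(g has_derivative (\<lambda>h. h *\<^sub>R g' u)) (at u)"
        using N(2) [of u] u by (simp add: has_vector_derivative_def)
      ultimately have "((\<lambda>u. cmod (g u)) has_derivative (\<lambda>h. (h *\<^sub>R g' u) \<bullet> sgn (g u))) (at u)"
        by (intro has_derivative_compose [OF _ has_derivative_norm, of g])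
      moreover have "(\<lambda>h. (h *\<^sub>R g' u) \<bullet> sgn (g u)) = (*) (cmod (g u) * Re (g' u / g u))"
        by (auto simp: fun_eq_iff simp flip: inner_sgn_complex)
      ultimately show "((\<lambda>u. cmod (g u)) has_real_derivative cmod (g u) * Re (g' u / g u)) (at u)"
        by (simp only: has_field_derivative_def)
    qed measurable
    also have "\<dots> \<le> (\<integral>\<^sup>+u\<in>{..t}. ennreal (radial u) \<partial>lborel)"
      by (intro nn_integral_mono) (auto simp: radial_def indicator_def abs_mult)
    finally show ?thesis .
  qed (simp add: ennreal_neg)
  show ?thesis
  proof (cases "(\<integral>\<^sup>+u\<in>{..t}. ennreal (radial u) \<partial>lborel) = \<infinity>")
    case False
    then obtain r where r: "(\<integral>\<^sup>+u\<in>{..t}. ennreal (radial u) \<partial>lborel) = ennreal r" "0 \<le> r"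
      by (metis ennreal_cases infinity_ennreal_def)
    have "cmod (g t) \<le> r"
      by (rule field_le_epsilon) (use main r in \<open>simp add: ennreal_le_iff diff_le_eq\<close>)
    then show ?thesis by (simp add: r ennreal_leI)
  qed simp
qed

lemma norm_le_len: "ennreal (cmod (g t)) \<le> len t"
  using norm_le_integral_radial [of t]
  by (rule order_trans) (auto simp: len_def indicator_def intro!: nn_integral_mono ennreal_leI radial_le_speed)

text \<open>The cut is made by length because \<open>len\<close> may be constant on intervals or
  infinite, so a length need not correspond to a single parameter.\<close>

definition reached :: "ennreal \<Rightarrow> real set" where
  "reached b = {t. len t \<le> b}"

lemma reached_measurable [measurable]: "reached b \<in> sets borel"
  unfolding reached_def by measurable

lemma speed_integral_reached: "(\<integral>\<^sup>+u\<in>reached b. ennreal (cmod (g' u)) \<partial>lborel) \<le> b"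
proof (rule nn_integral_down_closed_le)
  show "s \<in> reached b" if "t \<in> reached b" "s \<le> t" for s t
    using that len_mono [of s t] by (auto simp: reached_def)
qed (auto simp: reached_def len_def)

text \<open>\<open>speed_decomp_le\<close> integrated: a length budget \<open>b\<close> bounds the
  radial and the angular expenditure jointly.\<close>

lemma reached_energy:
  assumes k: "0 \<le> k"
  shows "(\<integral>\<^sup>+u\<in>reached b. ennreal (k * radial u) \<partial>lborel) + (\<integral>\<^sup>+u\<in>reached b. ennreal (cmod (g u) * angular u) \<partial>lborel)
    \<le> ennreal (sqrt (1 + k\<^sup>2)) * b"
proof -
  have "(\<integral>\<^sup>+u\<in>reached b. ennreal (k * radial u) \<partial>lborel) + (\<integral>\<^sup>+u\<in>reached b. ennreal (cmod (g u) * angular u) \<partial>lborel)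
      = (\<integral>\<^sup>+u. ennreal (k * radial u) * indicator (reached b) u
          + ennreal (cmod (g u) * angular u) * indicator (reached b) u \<partial>lborel)"
    by (rule nn_integral_add [symmetric]) measurable
  also have "\<dots> \<le> (\<integral>\<^sup>+u. ennreal (sqrt (1 + k\<^sup>2)) * (ennreal (cmod (g' u)) * indicator (reached b) u) \<partial>lborel)"
    using speed_decomp_le [OF k] k angular_nonneg radial_nonneg
    by (intro nn_integral_mono)
      (auto simp: indicator_def ennreal_mult' [symmetric] ennreal_plus [symmetric] intro!: ennreal_leI simp del: ennreal_plus)
  also have "\<dots> = ennreal (sqrt (1 + k\<^sup>2)) * (\<integral>\<^sup>+u\<in>reached b. ennreal (cmod (g' u)) \<partial>lborel)"
    by (rule nn_integral_cmult) measurable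
  also have "\<dots> \<le> ennreal (sqrt (1 + k\<^sup>2)) * b"
    by (intro mult_left_mono speed_integral_reached) simp
  finally show ?thesis .
qed

text \<open>All times before \<open>t\<close> are reached as well, so the radial expenditure pays
  for the distance of every point reached.\<close>

lemma norm_le_radial_reached:
  assumes "0 \<le> k" "t \<in> reached b"
  shows "ennreal (k * cmod (g t)) \<le> (\<integral>\<^sup>+u\<in>reached b. ennreal (k * radial u) \<partial>lborel)"
proof -
  have "ennreal (k * cmod (g t)) \<le> ennreal k * (\<integral>\<^sup>+u\<in>{..t}. ennreal (radial u) \<partial>lborel)"
    using assms norm_le_integral_radial [of t] by (simp add: ennreal_mult' mult_left_mono)
  also have "\<dots> = (\<integral>\<^sup>+u. ennreal k * (ennreal (radial u) * indicator {..t} u) \<partial>lborel)"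
    by (rule nn_integral_cmult [symmetric]) measurable
  also have "\<dots> \<le> (\<integral>\<^sup>+u\<in>reached b. ennreal (k * radial u) \<partial>lborel)"
  proof (rule nn_integral_mono)
    fix u
    have "u \<in> reached b" if "u \<le> t"
      using that assms(2) len_mono [of u t] by (simp add: reached_def)
    then show "ennreal k * (ennreal (radial u) * indicator {..t} u) \<le> ennreal (k * radial u) * indicator (reached b) u"
      using assms(1) by (auto simp: indicator_def ennreal_mult')
  qed
  finally show ?thesis .
qed

text \<open>Off the negative real axis \<open>Im (Ln (g t))\<close> is differentiable with
  derivative \<open>Im (g' t / g t)\<close>. Its values cover an interval of length
  \<open>2 * pi\<close>, so \<open>emeasure_le_integral_deriv\<close> applies.\<close>

lemma angular_covering:
  assumes "0 < x"
    and cov: "\<And>\<theta>. -pi < \<theta> \<Longrightarrow> \<theta> < pi \<Longrightarrow> \<exists>t\<in>reached b. x \<le> cmod (g t) \<and> Arg (g t) = \<theta>"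
  shows "ennreal (2 * pi) \<le> (\<integral>\<^sup>+u\<in>reached b \<inter> {t. x \<le> cmod (g t)}. ennreal (angular u) \<partial>lborel)"
proof -
  obtain N where N: "countable N" "\<And>t. t \<notin> N \<Longrightarrow> (g has_vector_derivative g' t) (at t)"
    using countable_exceptions by blast
  define f where "f = (\<lambda>t. Im (Ln (g t)))"
  have N_meas [measurable]: "N \<in> sets borel"
    using N(1) by (rule sets.countable [rotated]) simp
  have fN: "f ` N \<in> null_sets lborel"
    using N(1) by (intro countable_imp_null_set_lborel) simp
  \<comment> \<open>The slit of \<open>Ln\<close> belongs to the direction \<open>pi\<close>,
    outside the open interval, and the exceptional times account for countably many directions
    only.\<close>
  define S where "S = reached b \<inter> {t. x \<le> cmod (g t)} \<inter> g -` (- \<real>\<^sub>\<le>\<^sub>0) - N"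
  have [measurable]: "\<real>\<^sub>\<le>\<^sub>0 \<in> sets (borel :: complex measure)"
    by (intro borel_closed closed_nonpos_Reals_complex)
  have S_meas: "S \<in> sets borel"
    unfolding S_def by measurable
  have "ennreal (2 * pi) = emeasure lborel {-pi<..<pi}"
    by simp
  also have "\<dots> = emeasure lborel ({-pi<..<pi} - f ` N)"
    using fN by (intro emeasure_Diff_null_set [symmetric]) auto
  also have "\<dots> \<le> (\<integral>\<^sup>+t\<in>S. ennreal \<bar>Im (g' t / g t)\<bar> \<partial>lborel)"
  proof (rule emeasure_le_integral_deriv [OF S_meas])
    show "{-pi<..<pi} - f ` N \<in> sets borel"
      using fN by auto
    show "(\<lambda>t. Im (g' t / g t)) \<in> borel_measurable borel" by measurable
    show "(f has_real_derivative Im (g' t / g t)) (at t)" if "t \<in> S" for t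
    proof -
      have "g t \<notin> \<real>\<^sub>\<le>\<^sub>0" "t \<notin> N" using that by (auto simp: S_def)
      then have "((Ln \<circ> g) has_vector_derivative g' t * inverse (g t)) (at t)"
        by (intro field_vector_diff_chain_at N(2) has_field_derivative_Ln)
      from bounded_linear.has_vector_derivative [OF bounded_linear_Im this]
      show ?thesis
        by (simp add: f_def has_real_derivative_iff_has_vector_derivative divide_inverse)
    qed
    show "{-pi<..<pi} - f ` N \<subseteq> f ` S"
    proof
      fix \<theta> assume \<theta>: "\<theta> \<in> {-pi<..<pi} - f ` N"
      then obtain t where t: "t \<in> reached b" "x \<le> cmod (g t)" "Arg (g t) = \<theta>"
        using cov by auto
      have nz: "g t \<noteq> 0" using t(2) assms(1) by auto
      have f: "f t = \<theta>" using nz t(3) by (simp add: f_def Arg_eq_Im_Ln)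
      have "g t \<notin> \<real>\<^sub>\<le>\<^sub>0"
      proof
        assume "g t \<in> \<real>\<^sub>\<le>\<^sub>0"
        then have "Arg (g t) = pi"
          using nz by (auto elim!: nonpos_Reals_cases)
        with t(3) \<theta> show False by auto
      qed
      moreover have "t \<notin> N" using \<theta> f by auto
      ultimately show "\<theta> \<in> f ` S"
        using t f by (intro image_eqI [of _ _ t]) (auto simp: S_def)
    qed
  qed
  also have "\<dots> \<le> (\<integral>\<^sup>+u\<in>reached b \<inter> {t. x \<le> cmod (g t)}. ennreal (angular u) \<partial>lborel)"
    by (intro nn_integral_mono) (auto simp: S_def indicator_def angular_def)
  finally show ?thesis .
qed

theorem covering_rate_bound:
  fixes C k :: real
  assumes k: "0 < k" "k ^ 3 + k = 1 / (2 * pi)" and C: "0 \<le> C"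
    and cov: "\<And>x \<theta>. 0 < x \<Longrightarrow> -pi < \<theta> \<Longrightarrow> \<theta> < pi \<Longrightarrow>
      \<exists>t. len t \<le> ennreal (C * x) \<and> x \<le> cmod (g t) \<and> Arg (g t) = \<theta>"
  shows "sqrt (1 + k\<^sup>2) / k * exp (2 * pi * k) \<le> C"
proof -
  \<comment> \<open>\<open>G\<close>: the useful times. \<open>h\<close> is the decreasing rearrangement of the radius, written as the
    length of \<open>{\<rho>>0. \<psi> < A \<rho>}\<close> so that Tonelli applies.\<close>
  define R where "R = (\<lambda>x. reached (ennreal (C * x)))"
  define G where "G = {t \<in> R 1. len t \<le> ennreal (C * cmod (g t))}"
  define q where "q = (\<lambda>t. ennreal (angular t) * indicator G t)"
  define \<mu> where "\<mu> = density lborel q"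
  define A where "A = (\<lambda>\<rho>. emeasure \<mu> {t. \<rho> \<le> cmod (g t)})"
  define h where "h = (\<lambda>\<psi>. \<integral>\<^sup>+\<rho>. indicator {0<..} \<rho> * indicator {\<rho>. ennreal \<psi> < A \<rho>} \<rho> \<partial>lborel)"
  define K where "K = sqrt (1 + k\<^sup>2) * C"
  have R_meas [measurable]: "R x \<in> sets borel" for x unfolding R_def by measurable
  have G_meas [measurable]: "G \<in> sets borel" unfolding G_def by measurable
  have q_meas [measurable]: "q \<in> borel_measurable borel" unfolding q_def by measurable
  have sets_\<mu> [measurable_cong, simp]: "sets \<mu> = sets borel" by (simp add: \<mu>_def)
  have \<mu>: "emeasure \<mu> X = (\<integral>\<^sup>+t\<in>X. q t \<partial>lborel)" if "X \<in> sets borel" for X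
    using that by (simp add: \<mu>_def emeasure_density)
  have far_meas [measurable]: "{t. \<rho> \<le> cmod (g t)} \<in> sets borel" for \<rho> by measurable
  have A_eq: "A = (\<lambda>\<rho>. \<integral>\<^sup>+t. q t * indicator {..cmod (g t)} \<rho> \<partial>lborel)"
    by (auto simp: A_def \<mu> fun_eq_iff indicator_def intro!: nn_integral_cong)
  have A_meas [measurable]: "A \<in> borel_measurable borel"
    unfolding A_eq atMost_def by measurable
  have h_meas: "h \<in> borel_measurable borel"
    unfolding h_def by measurable
  have A_anti: "A \<sigma> \<le> A \<rho>" if "\<rho> \<le> \<sigma>" for \<rho> \<sigma>
    unfolding A_def using that by (intro emeasure_mono) auto

  \<comment> \<open>The density \<open>q\<close> vanishes off \<open>G\<close>, so positive measure
    yields an actual useful time.\<close>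
  have A_pos_norm: "\<exists>t\<in>S \<inter> G. \<rho> \<le> cmod (g t)"
    if S: "S \<in> sets borel" and "0 < emeasure \<mu> (S \<inter> {t. \<rho> \<le> cmod (g t)})" for S \<rho>
  proof (rule ccontr)
    assume "\<not> ?thesis"
    then have "(\<integral>\<^sup>+t\<in>S \<inter> {t. \<rho> \<le> cmod (g t)}. q t \<partial>lborel) = (\<integral>\<^sup>+t. 0 \<partial>(lborel :: real measure))"
      by (intro nn_integral_cong) (auto simp: q_def indicator_def)
    with that show False by (simp add: \<mu>)
  qed
  \<comment> \<open>As \<open>A\<close> is decreasing, the positive \<open>\<rho>\<close> with
    \<open>\<psi> < A \<rho>\<close> form an interval starting at 0 and \<open>h \<psi>\<close> is
    their supremum. This fact and \<open>h_ge_of\<close> are the two directions.\<close>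
  have h_le_of: "h \<psi> \<le> ennreal B" if "0 \<le> B" "\<And>\<rho>. 0 < \<rho> \<Longrightarrow> ennreal \<psi> < A \<rho> \<Longrightarrow> \<rho> \<le> B" for \<psi> B
  proof -
    have "h \<psi> \<le> (\<integral>\<^sup>+\<rho>. indicator {0..B} \<rho> \<partial>lborel)"
      unfolding h_def using that by (intro nn_integral_mono) (auto simp: indicator_def)
    also have "\<dots> = ennreal B" using that by simp
    finally show ?thesis .
  qed
  have h_ge_of: "ennreal B \<le> h \<psi>" if "0 \<le> B" "ennreal \<psi> < A B" for \<psi> B
  proof -
    have "ennreal B = (\<integral>\<^sup>+\<rho>. indicator {0<..B} \<rho> \<partial>lborel)"
      using that by simp
    also have "\<dots> \<le> h \<psi>"
      unfolding h_def using that A_anti [of _ B]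
      by (intro nn_integral_mono) (auto simp: indicator_def intro: less_le_trans)
    finally show ?thesis .
  qed

  have split: "ennreal (2 * pi) + emeasure \<mu> (- R x) \<le> A x" if x: "0 < x" "x \<le> 1" for x
  proof -
    let ?near = "R x \<inter> {t. x \<le> cmod (g t)}" and ?late = "- R x \<inter> {t. x \<le> cmod (g t)}"
    have "\<exists>t\<in>R x. x \<le> cmod (g t) \<and> Arg (g t) = \<theta>" if "-pi < \<theta>" "\<theta> < pi" for \<theta>
      using cov [OF x(1) that] by (auto simp: R_def reached_def)
    then have "ennreal (2 * pi) \<le> (\<integral>\<^sup>+u\<in>?near. ennreal (angular u) \<partial>lborel)"
      unfolding R_def by (intro angular_covering x(1))
    also have "\<dots> = (\<integral>\<^sup>+u\<in>?near. q u \<partial>lborel)"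
    proof -
      \<comment> \<open>At radius at least \<open>x\<close>, a length of at most
        \<open>C * x\<close> is at most \<open>C * cmod (g t)\<close>, so the time is useful;
        \<open>x \<le> 1\<close> puts it into \<open>R 1\<close>.\<close>
      have "t \<in> G" if "t \<in> ?near" for t
      proof -
        have t: "len t \<le> ennreal (C * x)" "x \<le> cmod (g t)" using that by (auto simp: R_def reached_def)
        have "ennreal (C * x) \<le> ennreal (C * cmod (g t))" "ennreal (C * x) \<le> ennreal (C * 1)"
          using t(2) C mult_left_mono [OF x(2) C] by (auto intro!: ennreal_leI mult_left_mono)
        with t(1) show ?thesis by (auto simp: G_def R_def reached_def)
      qed
      then show ?thesis
        by (intro nn_integral_cong) (auto simp: q_def indicator_def)
    qed
    also have "\<dots> = emeasure \<mu> ?near" by (rule \<mu> [symmetric]) measurable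
    finally have near: "ennreal (2 * pi) \<le> emeasure \<mu> ?near" .
    have "emeasure \<mu> (- R x) = emeasure \<mu> ?late"
    proof -
      \<comment> \<open>A useful time after length \<open>C * x\<close> satisfies
        \<open>C * x < len t \<le> C * cmod (g t)\<close>.\<close>
      have "x \<le> cmod (g t)" if "t \<in> G" "t \<notin> R x" for t
      proof -
        have "ennreal (C * x) < ennreal (C * cmod (g t))"
          using that by (auto simp: G_def R_def reached_def)
        then have "C * x < C * cmod (g t)" using C x by (simp add: ennreal_less_iff)
        then show ?thesis using C by (simp add: mult_less_cancel_left)
      qed
      then have "(\<integral>\<^sup>+u\<in>- R x. q u \<partial>lborel) = (\<integral>\<^sup>+u\<in>?late. q u \<partial>lborel)"
        by (intro nn_integral_cong) (auto simp: q_def indicator_def)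
      then show ?thesis by (simp add: \<mu>)
    qed
    with near have "ennreal (2 * pi) + emeasure \<mu> (- R x) \<le> emeasure \<mu> ?near + emeasure \<mu> ?late"
      by (intro add_mono) auto
    also have "\<dots> = emeasure \<mu> (?near \<union> ?late)"
      by (rule plus_emeasure) auto
    also have "\<dots> \<le> A x" unfolding A_def by (intro emeasure_mono) auto
    finally show ?thesis .
  qed

  \<comment> \<open>At most \<open>\<phi>\<close> of the angle counted by any
    \<open>A \<rho>\<close> is swept after length \<open>C * x\<close>. So each radius with
    \<open>A \<rho> > \<phi>\<close> is reached by then, which charges \<open>k * h \<phi>\<close>
    to the radial part \<open>?I\<close>, and the excess of \<open>A \<rho>\<close> over
    \<open>\<phi>\<close> is charged to the angular part \<open>?J\<close>.\<close>
  have key: "(\<integral>\<^sup>+y\<in>{\<phi>..}. h y \<partial>lborel) + ennreal k * h \<phi> \<le> ennreal (K * x)"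
    if x: "0 < x" "x \<le> 1" and \<phi>: "0 \<le> \<phi>" and late: "emeasure \<mu> (- R x) \<le> ennreal \<phi>" for x \<phi>
  proof -
    let ?I = "\<integral>\<^sup>+u\<in>R x. ennreal (k * radial u) \<partial>lborel"
    let ?J = "\<integral>\<^sup>+u\<in>R x. ennreal (cmod (g u) * angular u) \<partial>lborel"
    have A_le: "A \<rho> \<le> emeasure \<mu> (R x \<inter> {t. \<rho> \<le> cmod (g t)}) + ennreal \<phi>" for \<rho>
    proof -
      have "A \<rho> \<le> emeasure \<mu> (R x \<inter> {t. \<rho> \<le> cmod (g t)} \<union> - R x)"
        unfolding A_def by (intro emeasure_mono) auto
      also have "\<dots> \<le> emeasure \<mu> (R x \<inter> {t. \<rho> \<le> cmod (g t)}) + emeasure \<mu> (- R x)"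
        by (intro emeasure_subadditive) auto
      finally show ?thesis using late by (meson add_left_mono order_trans)
    qed
    have "ennreal k * h \<phi> \<le> ?I"
    proof (cases "?I = \<infinity>")
      case False
      then obtain i where i: "?I = ennreal i" "0 \<le> i" by (metis ennreal_cases infinity_ennreal_def)
      have "h \<phi> \<le> ennreal (i / k)"
      proof (rule h_le_of)
        fix \<rho> :: real assume \<rho>: "0 < \<rho>" "ennreal \<phi> < A \<rho>"
        have "0 < emeasure \<mu> (R x \<inter> {t. \<rho> \<le> cmod (g t)})"
          using A_le [of \<rho>] \<rho>(2) by (metis add_0 not_less zero_less_iff_neq_zero)
        then obtain t where t: "t \<in> R x" "\<rho> \<le> cmod (g t)"
          using A_pos_norm [OF R_meas] by blast
        have "ennreal (k * cmod (g t)) \<le> ennreal i"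
          using norm_le_radial_reached [of k t] k t(1) unfolding i(1) [symmetric] R_def by simp
        then have "k * cmod (g t) \<le> i" using i(2) by simp
        moreover have "k * \<rho> \<le> k * cmod (g t)" using t(2) k by simp
        ultimately have "k * \<rho> \<le> i" by linarith
        then show "\<rho> \<le> i / k" using k(1) by (simp add: field_simps)
      qed (use i k in simp)
      then have "ennreal k * h \<phi> \<le> ennreal k * ennreal (i / k)" by (rule mult_left_mono) simp
      also have "\<dots> = ?I" using k i by (simp add: ennreal_mult' [symmetric])
      finally show ?thesis .
    qed simp
    \<comment> \<open>Layer cake, twice. The tail integral of \<open>h\<close> is the integral over
      positive \<open>\<rho>\<close> of the excess of \<open>A \<rho>\<close> over
      \<open>\<phi>\<close>. \<open>A_le\<close> bounds that by the angle swept within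
      \<open>R x\<close> at radius at least \<open>\<rho>\<close>, and integrating over
      \<open>\<rho>\<close> weights the angle by the radius.\<close>
    moreover have "(\<integral>\<^sup>+y\<in>{\<phi>..}. h y \<partial>lborel) \<le> ?J"
    proof -
      have "(\<integral>\<^sup>+y\<in>{\<phi>..}. h y \<partial>lborel)
          = (\<integral>\<^sup>+y. (\<integral>\<^sup>+\<rho>. indicator {\<phi>..} y * (indicator {0<..} \<rho> * indicator {\<rho>. ennreal y < A \<rho>} \<rho>) \<partial>lborel) \<partial>lborel)"
        unfolding h_def by (subst mult.commute, intro nn_integral_cong nn_integral_cmult [symmetric]) measurable
      also have "\<dots> = (\<integral>\<^sup>+\<rho>. (\<integral>\<^sup>+y. indicator {\<phi>..} y * (indicator {0<..} \<rho> * indicator {\<rho>. ennreal y < A \<rho>} \<rho>) \<partial>lborel) \<partial>lborel)"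
        by (rule lborel_pair.Fubini') (simp add: atLeast_def)
      also have "\<dots> \<le> (\<integral>\<^sup>+\<rho>. indicator {0<..} \<rho> * emeasure \<mu> (R x \<inter> {t. \<rho> \<le> cmod (g t)}) \<partial>lborel)"
      proof (rule nn_integral_mono)
        fix \<rho> :: real
        let ?m = "emeasure \<mu> (R x \<inter> {t. \<rho> \<le> cmod (g t)})"
        have "(\<integral>\<^sup>+y. indicator {\<phi>..} y * indicator {y. ennreal y < A \<rho>} y \<partial>lborel) \<le> ?m"
        proof (cases "?m = \<infinity>")
          case False
          then obtain m where m: "?m = ennreal m" "0 \<le> m" by (metis ennreal_cases infinity_ennreal_def)
          have "(\<integral>\<^sup>+y. indicator {\<phi>..} y * indicator {y. ennreal y < A \<rho>} y \<partial>lborel)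
              \<le> (\<integral>\<^sup>+y. indicator {\<phi>..\<phi> + m} y \<partial>lborel)"
          proof (rule nn_integral_mono)
            fix y :: real
            have "y \<le> \<phi> + m" if "\<phi> \<le> y" "ennreal y < A \<rho>"
            proof -
              have "ennreal y < ennreal (m + \<phi>)"
                using that(2) A_le [of \<rho>] m \<phi> by (simp add: less_le_trans)
              then show ?thesis using that(1) \<phi> by (simp add: ennreal_less_iff)
            qed
            then show "indicator {\<phi>..} y * indicator {y. ennreal y < A \<rho>} y \<le> (indicator {\<phi>..\<phi> + m} y :: ennreal)"
              by (auto simp: indicator_def)
          qed
          also have "\<dots> = ?m" using m by simp
          finally show ?thesis .
        qed simp
        then show "(\<integral>\<^sup>+y. indicator {\<phi>..} y * (indicator {0<..} \<rho> * indicator {\<rho>. ennreal y < A \<rho>} \<rho>) \<partial>lborel)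
            \<le> indicator {0<..} \<rho> * ?m"
          by (cases "0 < \<rho>") (auto simp: indicator_def)
      qed
      also have "\<dots> = (\<integral>\<^sup>+\<rho>. (\<integral>\<^sup>+t. q t * indicator (R x) t * (indicator {0<..} \<rho> * indicator {..cmod (g t)} \<rho>) \<partial>lborel) \<partial>lborel)"
      proof (rule nn_integral_cong)
        fix \<rho> :: real
        have "indicator {0<..} \<rho> * emeasure \<mu> (R x \<inter> {t. \<rho> \<le> cmod (g t)})
            = (\<integral>\<^sup>+t. indicator {0<..} \<rho> * (q t * indicator (R x \<inter> {t. \<rho> \<le> cmod (g t)}) t) \<partial>lborel)"
          by (simp add: \<mu> nn_integral_cmult)
        also have "\<dots> = (\<integral>\<^sup>+t. q t * indicator (R x) t * (indicator {0<..} \<rho> * indicator {..cmod (g t)} \<rho>) \<partial>lborel)"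
          by (intro nn_integral_cong) (auto simp: indicator_def)
        finally show "indicator {0<..} \<rho> * emeasure \<mu> (R x \<inter> {t. \<rho> \<le> cmod (g t)}) = \<dots>" .
      qed
      also have "\<dots> = (\<integral>\<^sup>+t. (\<integral>\<^sup>+\<rho>. q t * indicator (R x) t * (indicator {0<..} \<rho> * indicator {..cmod (g t)} \<rho>) \<partial>lborel) \<partial>lborel)"
        by (rule lborel_pair.Fubini') (simp add: atMost_def)
      also have "\<dots> \<le> ?J"
      proof (rule nn_integral_mono)
        fix t
        have "(\<integral>\<^sup>+\<rho>. q t * indicator (R x) t * (indicator {0<..} \<rho> * indicator {..cmod (g t)} \<rho>) \<partial>lborel)
            = q t * indicator (R x) t * (\<integral>\<^sup>+\<rho>. indicator {0<..cmod (g t)} \<rho> \<partial>lborel)"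
          by (subst nn_integral_cmult [symmetric]) (auto intro!: nn_integral_cong simp: indicator_def)
        also have "\<dots> = q t * indicator (R x) t * ennreal (cmod (g t))" by simp
        also have "\<dots> \<le> ennreal (cmod (g t) * angular t) * indicator (R x) t"
          by (auto simp: q_def indicator_def ennreal_mult' mult.commute)
        finally show "(\<integral>\<^sup>+\<rho>. q t * indicator (R x) t * (indicator {0<..} \<rho> * indicator {..cmod (g t)} \<rho>) \<partial>lborel)
            \<le> ennreal (cmod (g t) * angular t) * indicator (R x) t" .
      qed
      finally show ?thesis .
    qed
    ultimately have "(\<integral>\<^sup>+y\<in>{\<phi>..}. h y \<partial>lborel) + ennreal k * h \<phi> \<le> ?I + ?J"
      by (subst add.commute) (rule add_mono)
    also have "\<dots> \<le> ennreal (sqrt (1 + k\<^sup>2)) * ennreal (C * x)"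
      unfolding R_def using k by (intro reached_energy) simp
    also have "\<dots> = ennreal (K * x)" by (simp add: K_def ennreal_mult' [symmetric] mult.assoc)
    finally show ?thesis .
  qed

  \<comment> \<open>Useful times lie in \<open>R 1\<close>, and the distance from the origin is at
    most the length, hence at most \<open>C\<close>.\<close>
  have h_le: "h \<psi> \<le> ennreal C" for \<psi>
  proof (rule h_le_of [OF C])
    fix \<rho> :: real assume \<rho>: "0 < \<rho>" "ennreal \<psi> < A \<rho>"
    then have "0 < emeasure \<mu> (UNIV \<inter> {t. \<rho> \<le> cmod (g t)})"
      by (simp add: A_def) (metis not_less_zero zero_less_iff_neq_zero)
    then obtain t where t: "t \<in> G" "\<rho> \<le> cmod (g t)"
      using A_pos_norm [of UNIV \<rho>] by auto
    have "ennreal (cmod (g t)) \<le> ennreal C"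
      using norm_le_len [of t] t(1) by (auto simp: G_def R_def reached_def)
    then show "\<rho> \<le> C" using t(2) C by simp
  qed
  have "(1 + k\<^sup>2) * exp (2 * pi * k) / k \<le> K"
  proof (rule delay_inequality_bound [OF k h_meas h_le])
    \<comment> \<open>Here \<open>h\<close> is even at least 1: \<open>split\<close> at radius 1
      gives \<open>A 1\<close> at least \<open>2 * pi\<close>.\<close>
    fix x :: real assume "0 < x" "x < 2 * pi"
    then have "ennreal x < ennreal (2 * pi)" by (simp add: ennreal_less_iff)
    also have "\<dots> \<le> A 1" using split [of 1] by (auto intro: order_trans [rotated])
    finally have "ennreal 1 \<le> h x" by (intro h_ge_of) auto
    then show "0 < h x" by (auto intro: less_le_trans [rotated])
  next
    fix \<phi> :: real assume \<phi>: "0 \<le> \<phi>"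
    let ?L = "(\<integral>\<^sup>+y\<in>{\<phi>..}. h y \<partial>lborel) + ennreal k * h \<phi>"
    have K: "0 \<le> K" using C by (simp add: K_def)
    show "?L \<le> ennreal K * h (\<phi> + 2 * pi)"
    \<comment> \<open>\<open>key\<close> requires \<open>x \<le> 1\<close>. If
      \<open>h (\<phi> + 2 * pi)\<close> is at least 1, then \<open>x = 1\<close> works, as no
      useful time comes after length \<open>C\<close>. Otherwise every \<open>x\<close> strictly
      between it and 1 has \<open>A x \<le> \<phi> + 2 * pi\<close>, so \<open>split\<close> leaves
      at most \<open>\<phi>\<close> of late angle.\<close>
    proof (cases "1 \<le> h (\<phi> + 2 * pi)")
      case True
      have "emeasure \<mu> (- R 1) = (\<integral>\<^sup>+u\<in>- R 1. q u \<partial>lborel)"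
        by (rule \<mu>) measurable
      also have "\<dots> = (\<integral>\<^sup>+u. 0 \<partial>(lborel :: real measure))"
        by (intro nn_integral_cong) (auto simp: q_def G_def indicator_def)
      finally have "?L \<le> ennreal (K * 1)" by (intro key \<phi>) auto
      also have "\<dots> \<le> ennreal K * h (\<phi> + 2 * pi)"
        using mult_left_mono [OF True, of "ennreal K"] by simp
      finally show ?thesis .
    next
      case False
      then obtain \<eta> where \<eta>: "h (\<phi> + 2 * pi) = ennreal \<eta>" "0 \<le> \<eta>" "\<eta> < 1"
        by (cases "h (\<phi> + 2 * pi)") (auto simp: not_le)
      have L: "?L \<le> ennreal (K * x)" if x: "\<eta> < x" "x < 1" for x
      proof (rule key)
        have "\<not> ennreal (\<phi> + 2 * pi) < A x"
        proof
          assume "ennreal (\<phi> + 2 * pi) < A x"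
          then have "ennreal x \<le> ennreal \<eta>" using h_ge_of [of x "\<phi> + 2 * pi"] x \<eta> by simp
          then show False using x \<eta> by simp
        qed
        then have "A x \<le> ennreal (\<phi> + 2 * pi)" by (rule leI)
        also have "\<dots> = ennreal (2 * pi) + ennreal \<phi>" using \<phi> by (simp add: add.commute)
        finally have "ennreal (2 * pi) + emeasure \<mu> (- R x) \<le> ennreal (2 * pi) + ennreal \<phi>"
          using split [of x] x \<eta> by (meson le_less_trans less_imp_le order_trans)
        then show "emeasure \<mu> (- R x) \<le> ennreal \<phi>"
          by (subst (asm) ennreal_add_left_cancel_le) simp
      qed (use x \<eta> \<phi> in auto)
      have "?L \<noteq> \<infinity>"
        using L [of "(\<eta> + 1) / 2"] \<eta> by (auto simp: top_unique)
      then obtain l where l: "?L = ennreal l" "0 \<le> l" by (metis ennreal_cases infinity_ennreal_def)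
      have l_le: "l \<le> K * x" if "\<eta> < x" "x < 1" for x
        using L [OF that] that l K \<eta> by simp
      \<comment> \<open>The limit \<open>x\<close> to \<open>\<eta>\<close> is taken because
        \<open>\<eta>\<close> itself may be 0, and \<open>A \<eta>\<close> may still exceed
        \<open>\<phi> + 2 * pi\<close>.\<close>
      have "l \<le> K * \<eta>"
      proof (cases "K = 0")
        case True then show ?thesis using l_le [of "(\<eta> + 1) / 2"] \<eta> by simp
      next
        case False
        with K have "0 < K" by simp
        then have "l / K \<le> \<eta>"
          by (intro dense_ge_bounded [OF \<eta>(3)]) (use l_le in \<open>simp add: field_simps\<close>)
        then show ?thesis using \<open>0 < K\<close> by (simp add: field_simps)
      qed
      then show ?thesis using l \<eta> K by (simp add: ennreal_mult' [symmetric] ennreal_leI)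
    qed
  qed
  moreover have "sqrt (1 + k\<^sup>2) * (sqrt (1 + k\<^sup>2) / k * exp (2 * pi * k)) = (1 + k\<^sup>2) * exp (2 * pi * k) / k"
  proof -
    have "sqrt (1 + k\<^sup>2) * sqrt (1 + k\<^sup>2) = 1 + k\<^sup>2" by simp
    then show ?thesis by (metis mult.assoc times_divide_eq_left times_divide_eq_right)
  qed
  ultimately have "sqrt (1 + k\<^sup>2) * (sqrt (1 + k\<^sup>2) / k * exp (2 * pi * k)) \<le> sqrt (1 + k\<^sup>2) * C"
    by (simp only: K_def)
  moreover have "0 < sqrt (1 + k\<^sup>2)" by (intro real_sqrt_gt_zero add_pos_nonneg) auto
  ultimately show ?thesis by (rule mult_left_le_imp_le)
qed

end

subsection \<open>Search cost\<close>

text \<open>The cubic is strictly increasing on the nonnegative reals and crosses the value between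
  0 and 1, so the \<open>THE\<close> in \<open>kappa1\<close> denotes its root.\<close>

lemma kappa1_root: "0 < kappa1" "kappa1 ^ 3 + kappa1 = 1 / (2 * pi)"
proof -
  define f where "f = (\<lambda>k::real. k ^ 3 + k)"
  have "\<exists>k\<ge>0. k \<le> 1 \<and> f k = 1 / (2 * pi)"
  proof (rule IVT')
    show "1 / (2 * pi) \<le> f 1" using pi_gt3 by (simp add: f_def field_simps)
  qed (auto simp: f_def intro!: continuous_intros)
  then obtain k where k: "0 \<le> k" "f k = 1 / (2 * pi)" by blast
  have "k \<noteq> 0" using k by (auto simp: f_def)
  have "\<exists>!k. k > 0 \<and> k ^ 3 + k = 1 / (2 * pi)"
  proof (rule ex1I)
    show "k > 0 \<and> k ^ 3 + k = 1 / (2 * pi)" using k \<open>k \<noteq> 0\<close> by (simp add: f_def)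
    fix j :: real assume j: "j > 0 \<and> j ^ 3 + j = 1 / (2 * pi)"
    have mono: "a ^ 3 + a < b ^ 3 + b" if "0 \<le> a" "a < b" for a b :: real
      using that by (intro add_strict_mono power_strict_mono) auto
    show "j = k"
      using mono [of j k] mono [of k j] j k by (cases j k rule: linorder_cases) (auto simp: f_def)
  qed
  from theI' [OF this] show "0 < kappa1" "kappa1 ^ 3 + kappa1 = 1 / (2 * pi)"
    by (simp_all add: kappa1_def)
qed

lemma U1_pos: "0 < U1"
  using kappa1_root(1) by (auto simp: U1_def intro!: mult_pos_pos divide_pos_pos real_sqrt_gt_zero add_pos_nonneg)

section \<open>Polar coordinates, exposure and the passage from \<open>real^2\<close> to
  \<open>complex\<close>\<close>

definition complex_of_vec :: "real^2 \<Rightarrow> complex" where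
  "complex_of_vec v = Complex (v $ 1) (v $ 2)"

lemma norm_complex_of_vec [simp]: "cmod (complex_of_vec v) = norm v"
  by (simp add: complex_of_vec_def cmod_def norm_vec_def L2_set_def sum_2)

lemma bounded_linear_complex_of_vec: "bounded_linear complex_of_vec"
  by (rule bounded_linear_intro [where K = 1]) (simp_all, auto simp: complex_of_vec_def complex_eq_iff)

lemma complex_of_vec_polar: "complex_of_vec (polar \<rho> \<theta>) = rcis \<rho> \<theta>"
  by (simp add: complex_of_vec_def polar_def complex_eq_iff)

lemma polar_eq: "polar \<rho> \<theta> = (\<rho> * cos \<theta>) *\<^sub>R axis 1 1 + (\<rho> * sin \<theta>) *\<^sub>R axis 2 1"
  by (simp add: polar_def vec_eq_iff forall_2 axis_def)

lemma norm_axis_combination: "norm (a *\<^sub>R axis 1 1 + b *\<^sub>R axis 2 1 :: real^2) = sqrt (a\<^sup>2 + b\<^sup>2)"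
  by (simp add: norm_vec_def L2_set_def sum_2 axis_def)

lemma norm_polar: "norm (polar \<rho> \<theta>) = \<bar>\<rho>\<bar>"
  by (simp flip: norm_complex_of_vec add: complex_of_vec_polar)

lemma polar_add_2pi: "polar \<rho> (\<theta> + 2 * pi * of_int n) = polar \<rho> \<theta>"
  by (simp only: polar_eq sin_add cos_add sin_int_2pin cos_int_2pin) simp

lemma vec_polar_cases:
  fixes v :: "real^2"
  obtains \<theta> where "v = polar (norm v) \<theta>"
proof
  have inj: "u = w" if "complex_of_vec u = complex_of_vec w" for u w
    using that by (simp add: complex_of_vec_def vec_eq_iff forall_2)
  show "v = polar (norm v) (Arg (complex_of_vec v))"
    by (rule inj) (simp add: complex_of_vec_polar rcis_cmod_Arg flip: norm_complex_of_vec)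
qed

text \<open>This form is free of angles: for fixed \<open>A\<close> it is a closed condition on
  \<open>P\<close>.\<close>

lemma exposes_iff:
  "exposes P A \<longleftrightarrow> A \<noteq> 0 \<and> norm A *\<^sub>R P = norm P *\<^sub>R A \<and> norm A \<le> norm P"
proof
  assume "exposes P A"
  then obtain x y \<psi> where "x > 0" "y > 0" "P = polar x \<psi>" "A = polar y \<psi>" "x \<ge> y"
    by (auto simp: exposes_def)
  moreover from this have "A \<noteq> 0" using norm_polar [of y \<psi>] by auto
  ultimately show "A \<noteq> 0 \<and> norm A *\<^sub>R P = norm P *\<^sub>R A \<and> norm A \<le> norm P"
    by (simp add: norm_polar) (simp add: polar_def)
next
  assume *: "A \<noteq> 0 \<and> norm A *\<^sub>R P = norm P *\<^sub>R A \<and> norm A \<le> norm P"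
  obtain \<theta> where \<theta>: "A = polar (norm A) \<theta>" by (rule vec_polar_cases)
  have "norm A *\<^sub>R P = norm P *\<^sub>R polar (norm A) \<theta>"
    using * \<theta> by metis
  also have "\<dots> = norm A *\<^sub>R polar (norm P) \<theta>"
    by (simp add: polar_def)
  finally have "P = polar (norm P) \<theta>" using * by (metis norm_eq_zero scaleR_cancel_left)
  with * \<theta> show "exposes P A"
    unfolding exposes_def by (intro exI [of _ "norm P"] exI [of _ "norm A"] exI [of _ \<theta>]) auto
qed

lemma exposes_imp_norm_le: "exposes P A \<Longrightarrow> norm A \<le> norm P"
  by (simp add: exposes_iff)

text \<open>\<open>LEAST\<close> on the reals needs an attained minimum. The exposing parameters
  form a closed set, bounded below because near minus infinity the curve is closer to the origin
  than \<open>A\<close>.\<close>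

lemma
  assumes \<gamma>: "search_curve \<gamma>" and t: "exposes (\<gamma> t) A"
  shows exposes_Least: "exposes (\<gamma> (LEAST t. exposes (\<gamma> t) A)) A"
    and Least_exposes_le: "(LEAST t. exposes (\<gamma> t) A) \<le> t"
proof -
  define X where "X = {t. exposes (\<gamma> t) A}"
  have A: "A \<noteq> 0" using t by (simp add: exposes_iff)
  have cont: "continuous_on UNIV \<gamma>" and lim: "(\<gamma> \<longlongrightarrow> 0) at_bot"
    using \<gamma> by (auto simp: search_curve_def)
  have "closed X"
    unfolding X_def exposes_iff
    by (intro closed_Collect_conj closed_Collect_le closed_Collect_eq closed_Collect_const continuous_intros cont)
  moreover have "\<forall>\<^sub>F s in at_bot. norm (\<gamma> s) < norm A"
    using lim A by (auto simp: tendsto_iff)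
  then obtain b where b: "\<And>s. s \<le> b \<Longrightarrow> norm (\<gamma> s) < norm A"
    by (auto simp: eventually_at_bot_linorder)
  have "b \<le> s" if "s \<in> X" for s
  proof (rule ccontr)
    assume "\<not> b \<le> s"
    then have "norm (\<gamma> s) < norm A" using b by simp
    with that exposes_imp_norm_le show False by (force simp: X_def)
  qed
  then have bdd: "bdd_below X" by (rule bdd_belowI)
  moreover have "X \<noteq> {}" using t by (auto simp: X_def)
  ultimately have Inf: "Inf X \<in> X" by (intro closed_contains_Inf)
  have "(LEAST t. exposes (\<gamma> t) A) = Inf X"
    using Inf bdd by (intro Least_equality) (auto simp: X_def intro: cInf_lower)
  then show "exposes (\<gamma> (LEAST t. exposes (\<gamma> t) A)) A" "(LEAST t. exposes (\<gamma> t) A) \<le> t"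
    using Inf bdd t by (auto simp: X_def intro: cInf_lower)
qed

lemma search_curve_planar_curve:
  assumes "search_curve \<gamma>"
  shows "planar_curve (\<lambda>t. complex_of_vec (\<gamma> t)) (\<lambda>t. complex_of_vec (vector_derivative \<gamma> (at t)))"
proof
  interpret bounded_linear complex_of_vec by (rule bounded_linear_complex_of_vec)
  show "continuous_on UNIV (\<lambda>t. complex_of_vec (\<gamma> t))"
    using assms by (auto simp: search_curve_def intro: continuous_on)
  show "((\<lambda>t. complex_of_vec (\<gamma> t)) \<longlongrightarrow> 0) at_bot"
    using assms by (auto simp: search_curve_def intro: tendsto_zero)
  fix a b
  obtain N where N: "finite N" "\<And>t. t \<in> {a..b} - N \<Longrightarrow> \<gamma> differentiable (at t within {a..b})"
    using assms unfolding search_curve_def piecewise_differentiable_on_def by blast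
  \<comment> \<open>At \<open>a\<close> and \<open>b\<close> differentiability within the interval
    is one-sided, so the end points join the exceptions.\<close>
  have "((\<lambda>t. complex_of_vec (\<gamma> t)) has_vector_derivative complex_of_vec (vector_derivative \<gamma> (at t))) (at t)"
    if t: "t \<in> {a..b} - (N \<union> {a, b})" for t
  proof -
    have "at t within {a..b} = at t"
      using t by (intro at_within_interior) auto
    then have "\<gamma> differentiable (at t)" using N(2) [of t] t by auto
    then show ?thesis
      by (intro has_vector_derivative) (simp add: vector_derivative_works)
  qed
  then show "\<exists>N. finite N \<and> (\<forall>t\<in>{a..b} - N. ((\<lambda>t. complex_of_vec (\<gamma> t))
      has_vector_derivative complex_of_vec (vector_derivative \<gamma> (at t))) (at t))"
    using N(1) by (intro exI [of _ "N \<union> {a, b}"]) auto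
qed

lemma curve_length_mono: "s \<le> t \<Longrightarrow> curve_length \<gamma> s \<le> curve_length \<gamma> t"
  unfolding curve_length_def by (intro nn_integral_mono) (auto simp: indicator_def)

lemma norm_le_curve_length:
  assumes "search_curve \<gamma>"
  shows "ennreal (norm (\<gamma> t)) \<le> curve_length \<gamma> t"
proof -
  interpret planar_curve "\<lambda>t. complex_of_vec (\<gamma> t)" "\<lambda>t. complex_of_vec (vector_derivative \<gamma> (at t))"
    by (rule search_curve_planar_curve [OF assms])
  show ?thesis using norm_le_len [of t] by (simp add: len_def curve_length_def)
qed

section \<open>Lower bound for two agents\<close>

lemma ennreal_divide_le_iff_le_mult:
  "0 < n \<Longrightarrow> 0 \<le> C \<Longrightarrow> x / ennreal n \<le> ennreal C \<longleftrightarrow> x \<le> ennreal (C * n)"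
  by (cases x) (auto simp: divide_ennreal divide_le_eq ennreal_top_divide top_unique)

lemma exposure_cost_upper_iff:
  assumes "0 < c" "0 \<le> C" "A \<noteq> 0"
  shows "(INF i\<in>{..<length [1, c]}. exposure_length (\<tau> i) A / ennreal ([1, c] ! i)) / ennreal (norm A) \<le> ennreal C
    \<longleftrightarrow> exposure_length (\<tau> 0) A \<le> ennreal (C * norm A) \<or> exposure_length (\<tau> 1) A \<le> ennreal (C * norm A * c)"
proof -
  have "{..<length [1, c]} = {0, 1}" by auto
  then have "(INF i\<in>{..<length [1, c]}. exposure_length (\<tau> i) A / ennreal ([1, c] ! i))
      = min (exposure_length (\<tau> 0) A / ennreal 1) (exposure_length (\<tau> 1) A / ennreal c)"
    by (simp add: inf_min)
  moreover have "x / ennreal d \<le> ennreal (C * norm A) \<longleftrightarrow> x \<le> ennreal (C * norm A * d)" if "0 < d" for x d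
    using assms that by (intro ennreal_divide_le_iff_le_mult) auto
  moreover have "0 < norm A" using assms by simp
  ultimately show ?thesis
    using assms(1,2) by (simp only: ennreal_divide_le_iff_le_mult min_le_iff_disj zero_less_one mult_1_right)
qed

text \<open>At cost \<open>C < U1\<close> the slow agent would have to expose \<open>A\<close>
  within length \<open>C * c * norm A\<close>, which is below \<open>norm A\<close>. So agent 0
  exposes everything in time, and \<open>covering_rate_bound\<close> applies to it.\<close>

lemma msp_cost_ge:
  assumes c: "0 < c" "c < 1 / U1" and feas: "msp_feasible punctured_plane [1, c] \<tau>"
  shows "ennreal U1 \<le> msp_cost punctured_plane [1, c] \<tau>"
proof (rule ccontr)
  assume "\<not> ?thesis"
  then obtain C where C: "msp_cost punctured_plane [1, c] \<tau> = ennreal C" "0 \<le> C" "C < U1"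
    by (cases "msp_cost punctured_plane [1, c] \<tau>") (auto simp: not_le ennreal_less_iff)
  have curves: "search_curve (\<tau> 0)" "search_curve (\<tau> 1)"
    using feas by (auto simp: msp_feasible_def)
  have fast: "\<exists>t. exposes (\<tau> 0 t) A \<and> curve_length (\<tau> 0) t \<le> ennreal (C * norm A)" if A: "A \<noteq> 0" for A
  proof -
    have "(INF i\<in>{..<length [1, c]}. exposure_length (\<tau> i) A / ennreal ([1, c] ! i)) / ennreal (norm A) \<le> ennreal C"
      unfolding C(1) [symmetric] msp_cost_def using A by (intro SUP_upper) (simp add: punctured_plane_def)
    then consider "exposure_length (\<tau> 0) A \<le> ennreal (C * norm A)" | "exposure_length (\<tau> 1) A \<le> ennreal (C * norm A * c)"
      using exposure_cost_upper_iff [OF c(1) C(2) A] by blast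
    then show ?thesis
    proof cases
      case 1
      then have "\<exists>t. exposes (\<tau> 0 t) A" by (auto simp: exposure_length_def top_unique split: if_splits)
      then show ?thesis
        using 1 exposes_Least [OF curves(1)] by (auto simp: exposure_length_def)
    next
      case 2
      let ?t = "LEAST t. exposes (\<tau> 1 t) A"
      have ex: "\<exists>t. exposes (\<tau> 1 t) A" using 2 by (auto simp: exposure_length_def top_unique split: if_splits)
      then have "norm A \<le> norm (\<tau> 1 ?t)"
        using exposes_Least [OF curves(2)] exposes_imp_norm_le by blast
      then have "ennreal (norm A) \<le> ennreal (norm (\<tau> 1 ?t))" by (rule ennreal_leI)
      also have "\<dots> \<le> curve_length (\<tau> 1) ?t" by (rule norm_le_curve_length [OF curves(2)])
      also have "\<dots> = exposure_length (\<tau> 1) A" using ex by (simp add: exposure_length_def)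
      also note 2
      finally have "norm A * 1 \<le> norm A * (C * c)" using c(1) C(2) by (simp add: mult_ac)
      then have "1 \<le> C * c" using A by (simp add: mult_le_cancel_left_pos)
      also have "\<dots> \<le> U1 * c" using C(3) c(1) by simp
      also have "\<dots> < 1" using c(2) U1_pos by (simp add: field_simps)
      finally show ?thesis by simp
    qed
  qed
  interpret planar_curve "\<lambda>t. complex_of_vec (\<tau> 0 t)" "\<lambda>t. complex_of_vec (vector_derivative (\<tau> 0) (at t))"
    by (rule search_curve_planar_curve [OF curves(1)])
  have len: "len t = curve_length (\<tau> 0) t" for t by (simp add: len_def curve_length_def)
  have "sqrt (1 + kappa1\<^sup>2) / kappa1 * exp (2 * pi * kappa1) \<le> C"
  proof (rule covering_rate_bound [OF kappa1_root C(2)])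
    fix x \<theta> :: real assume x: "0 < x" and \<theta>: "- pi < \<theta>" "\<theta> < pi"
    define A where "A = polar x \<theta>"
    have norm_A: "norm A = x" using x by (simp add: A_def norm_polar)
    then have "A \<noteq> 0" using x by auto
    then obtain t where t: "exposes (\<tau> 0 t) A" "curve_length (\<tau> 0) t \<le> ennreal (C * norm A)"
      using fast by blast
    then have P: "norm A *\<^sub>R \<tau> 0 t = norm (\<tau> 0 t) *\<^sub>R A" "x \<le> norm (\<tau> 0 t)"
      by (auto simp: exposes_iff norm_A)
    have "x *\<^sub>R \<tau> 0 t = x *\<^sub>R polar (norm (\<tau> 0 t)) \<theta>"
      using P(1) by (simp add: norm_A) (simp add: A_def polar_def)
    then have "\<tau> 0 t = polar (norm (\<tau> 0 t)) \<theta>" using x by simp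
    then have "complex_of_vec (\<tau> 0 t) = rcis (norm (\<tau> 0 t)) \<theta>" by (metis complex_of_vec_polar)
    moreover have "Arg (rcis (norm (\<tau> 0 t)) \<theta>) = \<theta>"
      using P(2) x \<theta> by (intro Arg_unique [of "norm (\<tau> 0 t)"]) (auto simp: rcis_def cis_conv_exp)
    ultimately show "\<exists>t. len t \<le> ennreal (C * x) \<and> x \<le> cmod (complex_of_vec (\<tau> 0 t)) \<and> Arg (complex_of_vec (\<tau> 0 t)) = \<theta>"
      using t(2) P(2) norm_A by (intro exI [of _ t]) (simp add: len)
  qed
  with C(3) show False by (simp add: U1_def)
qed

section \<open>The logarithmic spiral\<close>

definition spiral :: "real \<Rightarrow> real^2" where
  "spiral t = polar (exp (kappa1 * t)) t"

lemma spiral_has_vector_derivative: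
  "(spiral has_vector_derivative
      (exp (kappa1 * t) * (kappa1 * cos t - sin t)) *\<^sub>R axis 1 1
    + (exp (kappa1 * t) * (kappa1 * sin t + cos t)) *\<^sub>R axis 2 1) (at t)"
proof -
  have "((\<lambda>t. (exp (kappa1 * t) * cos t) *\<^sub>R axis 1 1 + (exp (kappa1 * t) * sin t) *\<^sub>R axis 2 1 :: real^2) has_vector_derivative
      (exp (kappa1 * t) * (kappa1 * cos t - sin t)) *\<^sub>R axis 1 1
    + (exp (kappa1 * t) * (kappa1 * sin t + cos t)) *\<^sub>R axis 2 1) (at t)"
    by (rule has_vector_derivative_eq_rhs, (rule has_vector_derivative_add has_vector_derivative_scaleR has_vector_derivative_const | rule derivative_eq_intros refl)+)
      (auto simp: algebra_simps)
  then show ?thesis by (simp only: spiral_def [abs_def] polar_eq)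
qed

lemma spiral_speed: "norm (vector_derivative spiral (at t)) = sqrt (1 + kappa1\<^sup>2) * exp (kappa1 * t)"
proof -
  have "(exp (kappa1 * t) * (kappa1 * cos t - sin t))\<^sup>2 + (exp (kappa1 * t) * (kappa1 * sin t + cos t))\<^sup>2
      = (exp (kappa1 * t))\<^sup>2 * ((1 + kappa1\<^sup>2) * ((cos t)\<^sup>2 + (sin t)\<^sup>2))"
    by (simp only: power2_eq_square) (simp only: algebra_simps)
  then have "norm (vector_derivative spiral (at t)) = sqrt ((exp (kappa1 * t))\<^sup>2 * (1 + kappa1\<^sup>2))"
    by (simp add: vector_derivative_at [OF spiral_has_vector_derivative] norm_axis_combination)
  then show ?thesis by (simp add: real_sqrt_mult mult.commute)
qed

lemma search_curve_spiral: "search_curve spiral"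
  unfolding search_curve_def
proof (intro conjI allI)
  have diff: "spiral differentiable (at t within S)" for t S
    using spiral_has_vector_derivative by (meson differentiableI_vector differentiable_at_withinI)
  show cont: "continuous_on UNIV spiral"
    using diff by (simp add: continuous_on_eq_continuous_within differentiable_imp_continuous_within)
  show "spiral piecewise_differentiable_on {a..b}" for a b
    using diff continuous_on_subset [OF cont] by (auto simp: piecewise_differentiable_on_def)
  have "filterlim (\<lambda>t. kappa1 * t) at_bot at_bot"
    using kappa1_root(1) by (intro filterlim_tendsto_pos_mult_at_bot [OF tendsto_const _ filterlim_ident])
  then have "((\<lambda>t. exp (kappa1 * t)) \<longlongrightarrow> 0) at_bot"
    by (rule filterlim_compose [OF exp_at_bot])
  then show "(spiral \<longlongrightarrow> 0) at_bot"
    by (subst tendsto_norm_zero_iff [symmetric]) (simp add: spiral_def norm_polar)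
qed

lemma curve_length_spiral: "curve_length spiral t = ennreal (sqrt (1 + kappa1\<^sup>2) / kappa1 * exp (kappa1 * t))"
proof -
  let ?s = "sqrt (1 + kappa1\<^sup>2)"
  have k: "0 < kappa1" by (rule kappa1_root)
  have "curve_length spiral t = (\<integral>\<^sup>+u. ennreal (?s * exp (kappa1 * u)) * indicator {..t} u \<partial>lborel)"
    by (simp add: curve_length_def spiral_speed)
  \<comment> \<open>Reflection turns the ray to minus infinity into one to plus infinity, the shape
    of \<open>nn_integral_FTC_atLeast\<close>.\<close>
  also have "\<dots> = (\<integral>\<^sup>+u. ennreal (?s * exp (kappa1 * - u)) * indicator {..t} (- u) \<partial>lborel)"
    by (subst nn_integral_real_affine [where c = "-1" and t = 0]) (auto simp: atMost_def)
  also have "\<dots> = (\<integral>\<^sup>+u. ennreal (?s * exp (kappa1 * - u)) * indicator {- t..} u \<partial>lborel)"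
    by (intro nn_integral_cong) (auto simp: indicator_def)
  also have "\<dots> = ennreal (0 - (- ?s / kappa1 * exp (kappa1 * - (- t))))"
  proof (rule nn_integral_FTC_atLeast)
    show "((\<lambda>u. - ?s / kappa1 * exp (kappa1 * - u)) has_real_derivative ?s * exp (kappa1 * - u)) (at u)" for u
      using k by (auto intro!: derivative_eq_intros)
    have "filterlim (\<lambda>u. kappa1 * u) at_top at_top"
      using k by (intro filterlim_tendsto_pos_mult_at_top [OF tendsto_const _ filterlim_ident])
    then have "((\<lambda>u. exp (kappa1 * - u)) \<longlongrightarrow> 0) at_top"
      by (intro filterlim_compose [OF exp_at_bot]) (simp add: filterlim_uminus_at_top)
    from tendsto_mult_left [OF this, of "- ?s / kappa1"]
    show "((\<lambda>u. - ?s / kappa1 * exp (kappa1 * - u)) \<longlongrightarrow> 0) at_top" by simp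
  qed auto
  finally show ?thesis by simp
qed

text \<open>The two factors of \<open>U1\<close>: the length up to radius \<open>r\<close> is
  \<open>r * sqrt (1 + kappa1 ^ 2) / kappa1\<close>, and the ray of \<open>A\<close> is met at most
  one turn after radius \<open>norm A\<close>, during which the radius grows by the factor
  \<open>exp (2 * pi * kappa1)\<close>.\<close>

lemma exposure_length_spiral:
  assumes A: "A \<noteq> 0"
  shows "exposure_length spiral A \<le> ennreal (U1 * norm A)"
proof -
  have k: "0 < kappa1" by (rule kappa1_root)
  obtain \<theta> where \<theta>: "A = polar (norm A) \<theta>" by (rule vec_polar_cases)
  have nA: "0 < norm A" using A by simp
  \<comment> \<open>The ceiling makes \<open>t\<close> the first parameter in the direction of
    \<open>A\<close> whose radius is at least \<open>norm A\<close>.\<close>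
  define n where "n = \<lceil>(ln (norm A) / kappa1 - \<theta>) / (2 * pi)\<rceil>"
  define t where "t = \<theta> + 2 * pi * of_int n"
  have "(ln (norm A) / kappa1 - \<theta>) / (2 * pi) \<le> of_int n" "of_int n - 1 < (ln (norm A) / kappa1 - \<theta>) / (2 * pi)"
    unfolding n_def by linarith+
  then have t: "ln (norm A) / kappa1 \<le> t" "t \<le> ln (norm A) / kappa1 + 2 * pi"
    by (simp_all add: t_def field_simps)
  have "ln (norm A) \<le> kappa1 * t" using t(1) k by (simp add: field_simps)
  then have lower: "norm A \<le> exp (kappa1 * t)" using nA by (metis exp_le_cancel_iff exp_ln)
  have "kappa1 * t \<le> kappa1 * (ln (norm A) / kappa1 + 2 * pi)"
    using t(2) k by (intro mult_left_mono) auto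
  also have "\<dots> = ln (norm A) + 2 * pi * kappa1" using k by (simp add: field_simps)
  finally have upper: "exp (kappa1 * t) \<le> norm A * exp (2 * pi * kappa1)"
    using nA by (metis exp_add exp_le_cancel_iff exp_ln)
  have "spiral t = polar (exp (kappa1 * t)) \<theta>"
    by (simp only: spiral_def t_def polar_add_2pi)
  then have ex: "exposes (spiral t) A"
    using \<theta> lower nA unfolding exposes_def
    by (intro exI [of _ "exp (kappa1 * t)"] exI [of _ "norm A"] exI [of _ \<theta>]) auto
  then have "exposure_length spiral A \<le> curve_length spiral t"
    using Least_exposes_le [OF search_curve_spiral ex] by (auto simp: exposure_length_def intro: curve_length_mono)
  also have "\<dots> \<le> ennreal (sqrt (1 + kappa1\<^sup>2) / kappa1 * (norm A * exp (2 * pi * kappa1)))"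
    unfolding curve_length_spiral using upper k by (intro ennreal_leI mult_left_mono) auto
  also have "\<dots> = ennreal (U1 * norm A)" by (simp add: U1_def mult_ac)
  finally show ?thesis .
qed

theorem proposition2:
  fixes c :: real
  assumes "0 < c" and "c < 1 / U1"
  shows "msp_optimal_cost punctured_plane [1, c] = ennreal U1"
proof (rule antisym)
  show "ennreal U1 \<le> msp_optimal_cost punctured_plane [1, c]"
    unfolding msp_optimal_cost_def using msp_cost_ge [OF assms] by (intro INF_greatest) simp
  \<comment> \<open>The slow agent stays at the origin and exposes nothing; its exposure length is
    infinite, so the minimum falls to the spiral.\<close>
  define \<tau> where "\<tau> = (\<lambda>i::nat. if i = 0 then spiral else (\<lambda>_. 0))"
  have "search_curve (\<lambda>_. 0)"
    by (simp add: search_curve_def piecewise_differentiable_on_def)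
  then have curves: "search_curve (\<tau> i)" for i
    by (simp add: \<tau>_def search_curve_spiral)
  have "\<exists>t. exposes (\<tau> 0 t) A" if "A \<noteq> 0" for A
    using exposure_length_spiral [OF that] by (auto simp: \<tau>_def exposure_length_def top_unique split: if_splits)
  then have "msp_feasible punctured_plane [1, c] \<tau>"
    using curves by (fastforce simp: msp_feasible_def punctured_plane_def)
  moreover have "msp_cost punctured_plane [1, c] \<tau> \<le> ennreal U1"
    unfolding msp_cost_def
  proof (rule SUP_least)
    fix A assume "A \<in> punctured_plane"
    then have "A \<noteq> 0" by (simp add: punctured_plane_def)
    then show "(INF i\<in>{..<length [1, c]}. exposure_length (\<tau> i) A / ennreal ([1, c] ! i)) / ennreal (norm A) \<le> ennreal U1"
      using exposure_length_spiral [of A] U1_pos assms(1)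
      by (subst exposure_cost_upper_iff) (auto simp: \<tau>_def)
  qed
  ultimately show "msp_optimal_cost punctured_plane [1, c] \<le> ennreal U1"
    unfolding msp_optimal_cost_def by (intro INF_lower2 [of \<tau>]) auto
qed

end
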